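(* Let $V$ be a vector space over a field $\mathbb{K}$, $N\ge 1$, $a\in\mathbb{K}^N$, and let $F_1,\ldots,F_N$ be endomorphisms of $V$ making $V$ a module over the Lie algebra $\mathfrak{g}_a$ via $\epsilon_i.v=F_i(v)$. Let $k\geq 1$ and $f,g_1,\ldots,g_k\in T(V)^N$. Then, for the extensions of $*$ and $\bullet$ to $S(\mathfrak{g}'_a)$ described in the context: $$f\bullet g_1\ldots g_k=f*g_1\ldots g_k+\sum_{p=1}^k(f*g_1\ldots g_{p-1}g_{p+1}\ldots g_k)\;{}_a sh\;g_p.$$
   Context: $(\epsilon_1,\ldots,\epsilon_N)$ is the canonical basis of $\mathbb{K}^N$; $\mathfrak{g}_a=\mathbb{K}^N$ with Lie bracket $[\epsilon_i,\epsilon_j]_a=a_j\epsilon_i-a_i\epsilon_j$. $T(V)$ has empty word $\emptyset$ and shuffle product $sh$. Elements of $T(V)^N$ are written $f_1\epsilon_1+\ldots+f_N\epsilon_N$. For $f,g\in T(V)$, $x\in V$: $f\epsilon_i\;{}_a sh\;g\epsilon_j=a_i(f\,sh\,g)\epsilon_j$ (associative); ${}_a[f\epsilon_i,g\epsilon_j]=(f\,sh\,g)(a_i\epsilon_j-a_j\epsilon_i)$; $*$ on $T(V)^N$ is defined inductively by $\emptyset\epsilon_i*g\epsilon_j=0$, $(xf)\epsilon_i*g\epsilon_j=x(f\epsilon_i*g\epsilon_j)+F_j(x)(f\,sh\,g)\epsilon_i$; and $u\bullet v=u*v+u\;{}_a sh\;v$. Under the module hypothesis $\mathfrak{g}'_a=(T(V)^N,{}_a[-,-],*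 )$ is a (right) post-Lie algebra and $(T(V)^N,\bullet)$ is a (right) pre-Lie algebra, i.e. $u*{}_a[v,w]=(u*v)*w-u*(v*w)-(u*w)*v+u*(w*v)$, ${}_a[u,v]*w={}_a[u*w,v]+{}_a[u,v*w]$ and $(u\bullet v)\bullet w-u\bullet(v\bullet w)=(u\bullet w)\bullet v-u\bullet(w\bullet v)$. Let $S=S(\mathfrak{g}'_a)$, with commutative product written by juxtaposition, usual coproduct $\Delta$ (elements of $\mathfrak{g}'_a$ primitive) and counit $\varepsilon$. It has a second associative product $$x_1\ldots x_k\blacktriangleleft y_1\ldots y_l=\sum_{I\subseteq\{1,\ldots,l\}}\ \sum_{\theta:I\hookrightarrow\{1,\ldots,k\}}\left(\prod_{i\notin \mathrm{Im}(\theta)}x_i\right)\left(\prod_{j\notin I}y_j\right)\left(\prod_{i\in I}x_{\theta(i)}\;{}_a sh\;y_i\right),$$ and $(S,\blacktriangleleft,\Delta)\cong\mathcal{U}(\mathfrak{g}'_a,{}_a[-,-])$. Extension of $*$: the unique bilinear extension to $S$ such that for $F,G,H\in S$, $y\in\mathfrak{g}'_a$: $F*1=F$; $1*F=\varepsilon(F)1$; $F*(G\blacktriangleleft y)=(F*G)*y-F*(G*y)$; $(F\blacktriangleleft G)*H=\sum(F*H^{(1)})\blacktriangleleft(G*H^{(2)})$. Extension of $\bullet$: the unique bilinear extension to $S$ such that: $F\bullet 1=F$; $1\bullet F=\varepsilon(F)1$; $F\bullet(Gy)=(F\bullet G)\bullet y-F\bullet(G\bullet y)$; $(FG)\bullet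 H=\sum(F\bullet H^{(1)})(G\bullet H^{(2)})$. Both satisfy $\mathfrak{g}'_a*S\subseteq\mathfrak{g}'_a$ and $\mathfrak{g}'_a\bullet S\subseteq\mathfrak{g}'_a$. *)

theory Defs
  imports "HOL-Analysis.Analysis" "HOL-Library.Poly_Mapping" "HOL-Library.FuncSet"
    "HOL-Library.Multiset"
begin

section \<open>Vector spaces given by generators and relations\<close>

text \<open>A vector space on a type \<open>'w\<close> over a field \<open>'k\<close> is given by its scalar multiplication
  \<open>sc\<close>. The free vector space on a set of generators \<open>'x\<close> is \<open>'x \<Rightarrow>\<^sub>0 'k\<close>, with the scalar
  multiplication \<open>fscale\<close>.\<close>

definition fscale :: "'k::field \<Rightarrow> ('x \<Rightarrow>\<^sub>0 'k) \<Rightarrow> ('x \<Rightarrow>\<^sub>0 'k)" where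
  "fscale c p = Poly_Mapping.map ((*) c) p"

lemma lookup_fscale [simp]: "Poly_Mapping.lookup (fscale c p) x = c * Poly_Mapping.lookup p x"
  by (simp add: fscale_def Poly_Mapping.map.rep_eq when_def)

lemma vector_space_fscale: "vector_space (fscale :: 'k::field \<Rightarrow> ('x \<Rightarrow>\<^sub>0 'k) \<Rightarrow> ('x \<Rightarrow>\<^sub>0 'k))"
  by unfold_locales (auto intro!: poly_mapping_eqI simp: lookup_add algebra_simps)

text \<open>The linear extension of a map defined on the generators.\<close>

definition lin_ext ::
  "('k::field \<Rightarrow> 'w::ab_group_add \<Rightarrow> 'w) \<Rightarrow> ('x \<Rightarrow> 'w) \<Rightarrow> ('x \<Rightarrow>\<^sub>0 'k) \<Rightarrow> 'w" where
  "lin_ext sc h p = (\<Sum>x\<in>Poly_Mapping.keys p. sc (Poly_Mapping.lookup p x) (h x))"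

text \<open>\<open>presents sc gen R\<close>: the vector space is the quotient of the free vector space on \<open>'x\<close> by the
  subspace spanned by \<open>R\<close>, the generator \<open>x\<close> having the class \<open>gen x\<close>.\<close>

definition presents ::
  "('k::field \<Rightarrow> 'w::ab_group_add \<Rightarrow> 'w) \<Rightarrow> ('x \<Rightarrow> 'w) \<Rightarrow> ('x \<Rightarrow>\<^sub>0 'k) set \<Rightarrow> bool" where
  "presents sc gen R \<longleftrightarrow>
     vector_space sc \<and> surj (lin_ext sc gen) \<and> {p. lin_ext sc gen p = 0} = module.span fscale R"

text \<open>The map on the quotient induced by a map \<open>h\<close> on the generators. It does not depend on the chosen
  representative as soon as the linear extension of \<open>h\<close> vanishes on the relations, which is
  the case at all places where it is used below.\<close>

definition induced ::
  "('k::field \<Rightarrow> 'w::ab_group_add \<Rightarrow> 'w) \<Rightarrow> ('x \<Rightarrow> 'w) \<Rightarrow>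
   ('k \<Rightarrow> 'u::ab_group_add \<Rightarrow> 'u) \<Rightarrow> ('x \<Rightarrow> 'u) \<Rightarrow> 'w \<Rightarrow> 'u" where
  "induced sc gen sc' h w = lin_ext sc' h (SOME p. lin_ext sc gen p = w)"

lemma (in vector_space) linear_lin_ext: "Vector_Spaces.linear fscale scale (lin_ext scale h)"
proof -
  have eq: "lin_ext scale h p = (\<Sum>x\<in>A. scale (Poly_Mapping.lookup p x) (h x))"
    if "finite A" "Poly_Mapping.keys p \<subseteq> A" for p A
    unfolding lin_ext_def using that
    by (intro sum.mono_neutral_left) (auto simp: in_keys_iff)
  have add: "lin_ext scale h (p + q) = lin_ext scale h p + lin_ext scale h q" for p q
    using Poly_Mapping.keys_add[of p q]
    by (simp add: eq[of "Poly_Mapping.keys p \<union> Poly_Mapping.keys q"] lookup_add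
        scale_left_distrib sum.distrib)
  have sub: "Poly_Mapping.keys (fscale c p) \<subseteq> Poly_Mapping.keys p" for c p
    by (auto simp: in_keys_iff)
  have sc: "lin_ext scale h (fscale c p) = scale c (lin_ext scale h p)" for c p
    by (subst eq[OF finite_keys sub]) (simp add: eq[OF finite_keys order_refl] scale_sum_right)
  show ?thesis
    using vector_space_fscale vector_space_axioms add sc
    by (intro Vector_Spaces.linear_iff[THEN iffD2]) blast
qed

lemma induced_lin_ext:
  assumes "presents sc gen R" and "vector_space sc'" and "\<forall>r\<in>R. lin_ext sc' h r = 0"
  shows "induced sc gen sc' h (lin_ext sc gen p) = lin_ext sc' h p"
proof -
  interpret f: vector_space fscale by (rule vector_space_fscale)
  interpret w: vector_space sc using assms(1) by (simp add: presents_def)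
  interpret u: vector_space sc' by (rule assms(2))
  interpret lw: Vector_Spaces.linear fscale sc "lin_ext sc gen" by (rule w.linear_lin_ext)
  interpret lu: Vector_Spaces.linear fscale sc' "lin_ext sc' h" by (rule u.linear_lin_ext)
  define q where "q = (SOME q. lin_ext sc gen q = lin_ext sc gen p)"
  have "lin_ext sc gen q = lin_ext sc gen p"
    unfolding q_def by (rule someI) (rule refl)
  then have "q - p \<in> module.span fscale R"
    using assms(1) by (auto simp: presents_def lw.diff)
  then have "lin_ext sc' h (q - p) = 0"
    using lu.eq_0_on_span assms(3) by blast
  then show ?thesis
    by (simp add: induced_def q_def lu.diff)
qed

definition is_algebra :: "('k::field \<Rightarrow> 'w::ring_1 \<Rightarrow> 'w) \<Rightarrow> bool" where
  "is_algebra sc \<longleftrightarrow> vector_space sc \<and>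
     (\<forall>c x y. sc c (x * y) = sc c x * y \<and> sc c (x * y) = x * sc c y)"

definition is_bilinear :: "('k::field \<Rightarrow> 'w::ab_group_add \<Rightarrow> 'w) \<Rightarrow> ('w \<Rightarrow> 'w \<Rightarrow> 'w) \<Rightarrow> bool" where
  "is_bilinear sc B \<longleftrightarrow>
     (\<forall>x. Vector_Spaces.linear sc sc (B x)) \<and> (\<forall>y. Vector_Spaces.linear sc sc (\<lambda>x. B x y))"


section \<open>Tensor algebra and symmetric algebra\<close>

definition word :: "('v \<Rightarrow> 't::monoid_mult) \<Rightarrow> 'v list \<Rightarrow> 't" where
  "word \<iota> xs = prod_list (map \<iota> xs)"

definition multilinear_relations ::
  "('k::field \<Rightarrow> 'v::ab_group_add \<Rightarrow> 'v) \<Rightarrow> ('v list \<Rightarrow>\<^sub>0 'k) set" where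
  "multilinear_relations sc =
     {Poly_Mapping.single (us @ (x + y) # vs) 1
        - Poly_Mapping.single (us @ x # vs) 1 - Poly_Mapping.single (us @ y # vs) 1
      | us vs x y. True} \<union>
     {Poly_Mapping.single (us @ sc c x # vs) 1 - Poly_Mapping.single (us @ x # vs) c
      | us vs c x. True}"

definition commutation_relations :: "('v list \<Rightarrow>\<^sub>0 'k::field) set" where
  "commutation_relations =
     {Poly_Mapping.single xs 1 - Poly_Mapping.single ys 1 | xs ys. mset xs = mset ys}"

text \<open>\<open>T(V)\<close>: the multiplication of the type \<open>'t\<close> is concatenation, \<open>1\<close> is the empty word
  and \<open>\<iota>\<close> is the inclusion of \<open>V\<close>.\<close>

definition is_tensor_algebra ::
  "('k::field \<Rightarrow> 'v::ab_group_add \<Rightarrow> 'v) \<Rightarrow> ('k \<Rightarrow> 't::ring_1 \<Rightarrow> 't) \<Rightarrow> ('v \<Rightarrow> 't) \<Rightarrow> bool" where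
  "is_tensor_algebra scV scT \<iota> \<longleftrightarrow>
     is_algebra scT \<and> presents scT (word \<iota>) (multilinear_relations scV)"

definition is_symmetric_algebra ::
  "('k::field \<Rightarrow> 'g::ab_group_add \<Rightarrow> 'g) \<Rightarrow> ('k \<Rightarrow> 's::comm_ring_1 \<Rightarrow> 's) \<Rightarrow> ('g \<Rightarrow> 's) \<Rightarrow> bool" where
  "is_symmetric_algebra scG scS j \<longleftrightarrow>
     is_algebra scS \<and>
     presents scS (word j) (multilinear_relations scG \<union> commutation_relations)"


section \<open>The Lie algebra \<open>g\<^sub>a\<close> and its modules\<close>

definition lie_bracket :: "'k::field ^ 'n \<Rightarrow> 'k ^ 'n \<Rightarrow> 'k ^ 'n \<Rightarrow> 'k ^ 'n" where
  "lie_bracket a u w =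
     (\<Sum>i\<in>UNIV. \<Sum>j\<in>UNIV. (u $ i * w $ j) *s (a $ j *s axis i 1 - a $ i *s axis j 1))"

definition lie_action ::
  "('k::field \<Rightarrow> 'v::ab_group_add \<Rightarrow> 'v) \<Rightarrow> ('n::finite \<Rightarrow> 'v \<Rightarrow> 'v) \<Rightarrow> 'k ^ 'n \<Rightarrow> 'v \<Rightarrow> 'v" where
  "lie_action sc F u v = (\<Sum>i\<in>UNIV. sc (u $ i) (F i v))"

definition is_lie_module ::
  "('k::field \<Rightarrow> 'v::ab_group_add \<Rightarrow> 'v) \<Rightarrow> 'k ^ 'n \<Rightarrow> ('n::finite \<Rightarrow> 'v \<Rightarrow> 'v) \<Rightarrow> bool" where
  "is_lie_module sc a F \<longleftrightarrow>
     (\<forall>i. Vector_Spaces.linear sc sc (F i)) \<and>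
     (\<forall>u w v. lie_action sc F (lie_bracket a u w) v =
        lie_action sc F u (lie_action sc F w v) - lie_action sc F w (lie_action sc F u v))"


section \<open>The operations on \<open>T(V)\<^sup>N\<close>\<close>

text \<open>The element \<open>f \<epsilon>\<^sub>i\<close> is \<open>axis i f\<close>, so that \<open>u = (\<Sum>i\<in>UNIV. axis i (u $ i))\<close>.\<close>

definition vscale :: "('k \<Rightarrow> 't \<Rightarrow> 't) \<Rightarrow> 'k \<Rightarrow> 't ^ 'n \<Rightarrow> 't ^ 'n" where
  "vscale scT c u = (\<chi> i. scT c (u $ i))"

fun shuffle_words :: "('v \<Rightarrow> 't::ring_1) \<Rightarrow> 'v list \<Rightarrow> 'v list \<Rightarrow> 't" where
  "shuffle_words \<iota> [] ys = word \<iota> ys"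
| "shuffle_words \<iota> xs [] = word \<iota> xs"
| "shuffle_words \<iota> (x # xs) (y # ys) =
     \<iota> x * shuffle_words \<iota> xs (y # ys) + \<iota> y * shuffle_words \<iota> (x # xs) ys"

definition shuffle ::
  "('k::field \<Rightarrow> 't::ring_1 \<Rightarrow> 't) \<Rightarrow> ('v \<Rightarrow> 't) \<Rightarrow> 't \<Rightarrow> 't \<Rightarrow> 't" where
  "shuffle scT \<iota> f g =
     induced scT (word \<iota>) scT (\<lambda>xs. induced scT (word \<iota>) scT (shuffle_words \<iota> xs) g) f"

definition ash ::
  "('k::field \<Rightarrow> 't::ring_1 \<Rightarrow> 't) \<Rightarrow> ('v \<Rightarrow> 't) \<Rightarrow> 'k ^ 'n \<Rightarrow> 't ^ 'n \<Rightarrow> 't ^ 'n \<Rightarrow> 't ^ 'n::finite"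
  where
  "ash scT \<iota> a u v =
     (\<Sum>i\<in>UNIV. \<Sum>j\<in>UNIV. axis j (scT (a $ i) (shuffle scT \<iota> (u $ i) (v $ j))))"

text \<open>\<open>star_word scT \<iota> F j g xs\<close> is the element \<open>h\<close> of \<open>T(V)\<close> with
  \<open>xs \<epsilon>\<^sub>i * g \<epsilon>\<^sub>j = h \<epsilon>\<^sub>i\<close>; it does not depend on \<open>i\<close>.\<close>

primrec star_word ::
  "('k::field \<Rightarrow> 't::ring_1 \<Rightarrow> 't) \<Rightarrow> ('v \<Rightarrow> 't) \<Rightarrow> ('n \<Rightarrow> 'v \<Rightarrow> 'v) \<Rightarrow> 'n \<Rightarrow> 't \<Rightarrow> 'v list \<Rightarrow> 't" where
  "star_word scT \<iota> F j g [] = 0"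
| "star_word scT \<iota> F j g (x # xs) =
     \<iota> x * star_word scT \<iota> F j g xs + \<iota> (F j x) * shuffle scT \<iota> (word \<iota> xs) g"

definition star ::
  "('k::field \<Rightarrow> 't::ring_1 \<Rightarrow> 't) \<Rightarrow> ('v \<Rightarrow> 't) \<Rightarrow> ('n \<Rightarrow> 'v \<Rightarrow> 'v) \<Rightarrow>
   't ^ 'n \<Rightarrow> 't ^ 'n \<Rightarrow> 't ^ 'n::finite" where
  "star scT \<iota> F u v =
     (\<Sum>i\<in>UNIV. \<Sum>j\<in>UNIV.
        axis i (induced scT (word \<iota>) scT (star_word scT \<iota> F j (v $ j)) (u $ i)))"

definition bullet ::
  "('k::field \<Rightarrow> 't::ring_1 \<Rightarrow> 't) \<Rightarrow> ('v \<Rightarrow> 't) \<Rightarrow> 'k ^ 'n \<Rightarrow> ('n \<Rightarrow> 'v \<Rightarrow> 'v) \<Rightarrow>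
   't ^ 'n \<Rightarrow> 't ^ 'n \<Rightarrow> 't ^ 'n::finite" where
  "bullet scT \<iota> a F u v = star scT \<iota> F u v + ash scT \<iota> a u v"


section \<open>Structure of \<open>S(g)\<close>\<close>

text \<open>The coproduct of \<open>S(g)\<close> is the algebra morphism for which the elements of \<open>g\<close> are primitive, i.e.
  \<open>y\<^sub>1\<dots>y\<^sub>l \<mapsto> \<Sum>\<^sub>I (\<Prod>\<^bsub>i\<in>I\<^esub> y\<^sub>i) \<otimes> (\<Prod>\<^bsub>i\<notin>I\<^esub> y\<^sub>i)\<close>. An element of \<open>S \<otimes> S\<close> is represented by a formal linear
  combination of pairs. The choice of the representative is irrelevant when it is evaluated
  by \<open>sweedler\<close> on a bilinear map.\<close>

definition coproduct ::
  "('k::field \<Rightarrow> 's::comm_ring_1 \<Rightarrow> 's) \<Rightarrow> ('g \<Rightarrow> 's) \<Rightarrow> 's \<Rightarrow> ('s \<times> 's \<Rightarrow>\<^sub>0 'k)" where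
  "coproduct scS j =
     induced scS (word j) fscale
       (\<lambda>ys. \<Sum>I\<in>Pow {..<length ys}.
          Poly_Mapping.single (\<Prod>i\<in>I. j (ys ! i), \<Prod>i\<in>{..<length ys} - I. j (ys ! i)) 1)"

definition sweedler ::
  "('k::field \<Rightarrow> 's::comm_ring_1 \<Rightarrow> 's) \<Rightarrow> ('s \<Rightarrow> 's \<Rightarrow> 's) \<Rightarrow> ('s \<times> 's \<Rightarrow>\<^sub>0 'k) \<Rightarrow> 's" where
  "sweedler scS B = lin_ext scS (\<lambda>(x, y). B x y)"

definition counit :: "('k::field \<Rightarrow> 's::comm_ring_1 \<Rightarrow> 's) \<Rightarrow> ('g \<Rightarrow> 's) \<Rightarrow> 's \<Rightarrow> 'k" where
  "counit scS j = induced scS (word j) (*) (\<lambda>ys. if ys = [] then 1 else 0)"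

text \<open>The second product of \<open>S(g)\<close>, for an associative product \<open>m\<close> on \<open>g\<close>.\<close>

definition btl_words :: "('g \<Rightarrow> 's::comm_ring_1) \<Rightarrow> ('g \<Rightarrow> 'g \<Rightarrow> 'g) \<Rightarrow> 'g list \<Rightarrow> 'g list \<Rightarrow> 's" where
  "btl_words j m xs ys =
     (\<Sum>I\<in>Pow {..<length ys}. \<Sum>\<theta>\<in>{\<theta> \<in> I \<rightarrow>\<^sub>E {..<length xs}. inj_on \<theta> I}.
        (\<Prod>i\<in>{..<length xs} - \<theta> ` I. j (xs ! i)) *
        (\<Prod>i\<in>{..<length ys} - I. j (ys ! i)) *
        (\<Prod>i\<in>I. j (m (xs ! \<theta> i) (ys ! i))))"

definition btl ::
  "('k::field \<Rightarrow> 's::comm_ring_1 \<Rightarrow> 's) \<Rightarrow> ('g \<Rightarrow> 's) \<Rightarrow> ('g \<Rightarrow> 'g \<Rightarrow> 'g) \<Rightarrow> 's \<Rightarrow> 's \<Rightarrow> 's" where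
  "btl scS j m s t =
     induced scS (word j) scS (\<lambda>xs. induced scS (word j) scS (btl_words j m xs) t) s"

text \<open>\<open>E\<close> is the extension to \<open>S(g)\<close> of the product \<open>b\<close> on \<open>g\<close> relative to the
  product \<open>P\<close> of \<open>S(g)\<close>.\<close>

definition is_extension ::
  "('k::field \<Rightarrow> 's::comm_ring_1 \<Rightarrow> 's) \<Rightarrow> ('g \<Rightarrow> 's) \<Rightarrow> ('s \<Rightarrow> 's \<Rightarrow> 's) \<Rightarrow> ('g \<Rightarrow> 'g \<Rightarrow> 'g) \<Rightarrow>
   ('s \<Rightarrow> 's \<Rightarrow> 's) \<Rightarrow> bool" where
  "is_extension scS j P b E \<longleftrightarrow>
     is_bilinear scS E \<and>
     (\<forall>u v. E (j u) (j v) = j (b u v)) \<and>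
     (\<forall>X. E X 1 = X) \<and>
     (\<forall>X. E 1 X = scS (counit scS j X) 1) \<and>
     (\<forall>X Y y. E X (P Y (j y)) = E (E X Y) (j y) - E X (E Y (j y))) \<and>
     (\<forall>X Y Z. E (P X Y) Z = sweedler scS (\<lambda>Z1 Z2. P (E X Z1) (E Y Z2)) (coproduct scS j Z))"

end

theory Submission
  imports Defs "HOL-Combinatorics.List_Permutation"
begin

text \<open>Write \<open>m\<close> for \<open>\<^sub>a sh\<close>. Right \<open>*\<close>-multiplication by \<open>y\<close> is a derivation of \<open>m\<close>, and for
  each \<open>v\<close> the operator \<open>M v X = X \<triangleleft> v - X v\<close> is the derivation of \<open>S\<close> extending
  right \<open>m\<close>-multiplication by \<open>v\<close>. Comparing commutators gives \<open>X \<bullet> y = X * y + M y X\<close> on all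
  of \<open>S\<close>, both \<open>_ * y\<close> and \<open>_ \<bullet> y\<close> being derivations of the commutative product. Hence
  \<open>f * (G y) = (f * G) * y - f * (G \<bullet> y)\<close>, which has the same shape as the recursion for
  \<open>f \<bullet> (G y)\<close>, and the formula follows by induction on the number of factors.\<close>

section \<open>Linear maps on presented vector spaces\<close>

text \<open>The obstacle is that the rules for \<open>*\<close> on S speak of \<triangleleft>: its
  recursion in the right argument and its Leibniz rule both use that product, whereas g_1...g_k is a
  commutative monomial. So \<open>_ * y\<close> is not known in advance to be a derivation of the
  commutative product. For \<bullet> this is immediate, as its coproduct rule at a primitive y is
  the Leibniz rule. Hence the detour: D y X = X \<bullet> y - M y X is a derivation that agrees with
  \<open>_ * y\<close> on generators, and its commutator with M v is M (v * y), because on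
  generators this says that \<open>_ * y\<close> is a derivation of m. That is what is needed to
  pass X v = X \<triangleleft> v - M v X through \<open>_ * y\<close> and to identify it with D y.
  The recursions for f \<bullet> (G y) and f * (G y) then subtract the same G \<bullet> y and differ
  by the summand M y; the correction sum collects the places where M y enters.\<close>

lemma linearD:
  assumes "Vector_Spaces.linear s1 s2 f"
  shows "f (x + y) = f x + f y" "f (x - y) = f x - f y" "f (- x) = - f x" "f 0 = 0" "f (s1 c x) = s2 c (f x)"
    "f (sum g A) = (\<Sum>a\<in>A. f (g a))"
proof -
  interpret Vector_Spaces.linear s1 s2 f by fact
  show "f (x + y) = f x + f y" "f (x - y) = f x - f y" "f (- x) = - f x" "f 0 = 0" "f (s1 c x) = s2 c (f x)"
    "f (sum g A) = (\<Sum>a\<in>A. f (g a))"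
    by (simp_all add: add diff neg scale sum)
qed

lemma linear_add_fun:
  assumes "Vector_Spaces.linear s1 s2 f" "Vector_Spaces.linear s1 s2 g"
  shows "Vector_Spaces.linear s1 s2 (\<lambda>x. f x + g x)"
proof -
  have "vector_space s2" using assms by (simp add: Vector_Spaces.linear_iff)
  then interpret vector_space s2 .
  show ?thesis using assms unfolding Vector_Spaces.linear_iff
    by (simp add: scale_right_distrib)
qed

lemma linear_diff_fun:
  assumes "Vector_Spaces.linear s1 s2 f" "Vector_Spaces.linear s1 s2 g"
  shows "Vector_Spaces.linear s1 s2 (\<lambda>x. f x - g x)"
proof -
  have "vector_space s2" using assms by (simp add: Vector_Spaces.linear_iff)
  then interpret vector_space s2 .
  show ?thesis using assms unfolding Vector_Spaces.linear_iff
    by (simp add: scale_right_diff_distrib)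
qed

lemma linear_sum_fun:
  assumes "vector_space s1" "vector_space s2" "\<And>a. a \<in> A \<Longrightarrow> Vector_Spaces.linear s1 s2 (f a)"
  shows "Vector_Spaces.linear s1 s2 (\<lambda>x. \<Sum>a\<in>A. f a x)"
proof -
  interpret vector_space s2 by fact
  show ?thesis using assms unfolding Vector_Spaces.linear_iff
    by (simp add: scale_sum_right sum.distrib)
qed

lemma linear_comp_fun:
  assumes "Vector_Spaces.linear s2 s3 f" "Vector_Spaces.linear s1 s2 g"
  shows "Vector_Spaces.linear s1 s3 (\<lambda>x. f (g x))"
  using assms by (simp add: Vector_Spaces.linear_iff)

lemma lin_ext_single:
  assumes "vector_space sc"
  shows "lin_ext sc h (Poly_Mapping.single x c) = sc c (h x)"
proof -
  interpret vector_space sc by fact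
  show ?thesis by (simp add: lin_ext_def)
qed

lemma lin_ext_comp:
  assumes "Vector_Spaces.linear s1 s2 f"
  shows "f (lin_ext s1 h p) = lin_ext s2 (\<lambda>x. f (h x)) p"
  by (simp add: lin_ext_def linearD[OF assms])

lemma lin_ext_gen:
  assumes "presents sc gen R"
  shows "lin_ext sc gen (Poly_Mapping.single x 1) = gen x"
proof -
  interpret vector_space sc using assms by (simp add: presents_def)
  show ?thesis by (simp add: lin_ext_single[OF vector_space_axioms])
qed

lemma presents_linear_eqI:
  assumes "presents sc gen R" "Vector_Spaces.linear sc sc' f" "Vector_Spaces.linear sc sc' g"
    and "\<And>x. f (gen x) = g (gen x)"
  shows "f w = g w"
proof -
  obtain p where "w = lin_ext sc gen p"
    using assms(1) unfolding presents_def by (metis surjD)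
  then show ?thesis using assms(4)
    by (simp add: lin_ext_comp[OF assms(2)] lin_ext_comp[OF assms(3)])
qed

lemma induced_gen:
  assumes "presents sc gen R" "vector_space sc'" "\<forall>r\<in>R. lin_ext sc' h r = 0"
  shows "induced sc gen sc' h (gen x) = h x"
proof -
  interpret vector_space sc' by fact
  show ?thesis
    using induced_lin_ext[OF assms, of "Poly_Mapping.single x 1"]
    by (simp add: lin_ext_gen[OF assms(1)] lin_ext_single[OF assms(2)])
qed

lemma linear_induced:
  assumes P: "presents sc gen R" "vector_space sc'" "\<forall>r\<in>R. lin_ext sc' h r = 0"
  shows "Vector_Spaces.linear sc sc' (induced sc gen sc' h)"
proof -
  interpret u: vector_space sc' by fact
  interpret w: vector_space sc using P by (simp add: presents_def)
  note l = w.linear_lin_ext[of gen] and l' = u.linear_lin_ext[of h]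
  have ex: "\<exists>p. x = lin_ext sc gen p" for x
    using assms(1) unfolding presents_def by (metis surjD)
  have "induced sc gen sc' h (x + y) = induced sc gen sc' h x + induced sc gen sc' h y" for x y
  proof -
    obtain p q where pq: "x = lin_ext sc gen p" "y = lin_ext sc gen q" using ex by blast
    show ?thesis unfolding pq linearD(1)[OF l, symmetric] induced_lin_ext[OF P]
      by (simp add: linearD[OF l'])
  qed
  moreover have "induced sc gen sc' h (sc c x) = sc' c (induced sc gen sc' h x)" for c x
  proof -
    obtain p where p: "x = lin_ext sc gen p" using ex by blast
    show ?thesis unfolding p linearD(5)[OF l, symmetric] induced_lin_ext[OF P]
      by (simp add: linearD[OF l'])
  qed
  ultimately show ?thesis
    using w.vector_space_axioms u.vector_space_axioms by (simp add: Vector_Spaces.linear_iff)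
qed

text \<open>For fixed \<open>t\<close> the inner map must itself kill the relations. Expanding
  \<open>t\<close> in generators and exchanging two finite sums reduces this to the vanishing of
  \<open>h\<close> in its first argument. Both the shuffle product and the second product of S are
  obtained in this way.\<close>

lemma induced_induced:
  assumes P: "presents sc gen R" and vs: "vector_space sc'"
    and left: "\<And>y. \<forall>r\<in>R. lin_ext sc' (\<lambda>x. h x y) r = 0"
    and right: "\<And>x. \<forall>r\<in>R. lin_ext sc' (h x) r = 0"
  defines "B \<equiv> \<lambda>s t. induced sc gen sc' (\<lambda>x. induced sc gen sc' (h x) t) s"
  shows "B (gen x) (gen y) = h x y"
    and "Vector_Spaces.linear sc sc' (\<lambda>s. B s t)"
    and "Vector_Spaces.linear sc sc' (B s)"
proof -
  interpret u: vector_space sc' by fact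
  have ex: "\<exists>p. t = lin_ext sc gen p" for t
    using P unfolding presents_def by (metis surjD)
  have vanish: "\<forall>r\<in>R. lin_ext sc' (\<lambda>x. induced sc gen sc' (h x) t) r = 0" for t
  proof
    fix r assume r: "r \<in> R"
    obtain p where p: "t = lin_ext sc gen p" using ex by blast
    have "lin_ext sc' (\<lambda>x. induced sc gen sc' (h x) t) r = lin_ext sc' (\<lambda>x. lin_ext sc' (h x) p) r"
      unfolding p induced_lin_ext[OF P vs right] ..
    also have "\<dots> = lin_ext sc' (\<lambda>y. lin_ext sc' (\<lambda>x. h x y) r) p"
      unfolding lin_ext_def u.scale_sum_right
      by (subst sum.swap) (simp add: mult.commute)
    also have "\<dots> = 0"
      using left r by (simp add: lin_ext_def)
    finally show "lin_ext sc' (\<lambda>x. induced sc gen sc' (h x) t) r = 0" .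
  qed
  show "Vector_Spaces.linear sc sc' (\<lambda>s. B s t)"
    unfolding B_def by (rule linear_induced[OF P vs vanish])
  show "B (gen x) (gen y) = h x y"
    unfolding B_def induced_gen[OF P vs vanish] induced_gen[OF P vs right] ..
  obtain p where p: "s = lin_ext sc gen p" using ex by blast
  have "B s = (\<lambda>t. \<Sum>x\<in>Poly_Mapping.keys p. sc' (Poly_Mapping.lookup p x) (induced sc gen sc' (h x) t))"
    unfolding B_def p induced_lin_ext[OF P vs vanish] by (simp add: lin_ext_def)
  moreover have "vector_space sc" using P by (simp add: presents_def)
  ultimately show "Vector_Spaces.linear sc sc' (B s)"
    by (simp only:) (intro linear_sum_fun vs linear_comp_fun[OF u.linear_scale_self linear_induced[OF P vs right]])
qed

section \<open>Maps on words that respect the relations\<close>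

definition multilinear_fun ::
  "('k::field \<Rightarrow> 'v::ab_group_add \<Rightarrow> 'v) \<Rightarrow> ('k \<Rightarrow> 'u::ab_group_add \<Rightarrow> 'u) \<Rightarrow> ('v list \<Rightarrow> 'u) \<Rightarrow> bool" where
  "multilinear_fun sc sc' h \<longleftrightarrow>
     (\<forall>us x y vs. h (us @ (x + y) # vs) = h (us @ x # vs) + h (us @ y # vs)) \<and>
     (\<forall>us c x vs. h (us @ sc c x # vs) = sc' c (h (us @ x # vs)))"

lemma multilinear_fun_iff_linear:
  assumes "vector_space sc" "vector_space sc'"
  shows "multilinear_fun sc sc' h \<longleftrightarrow>
    (\<forall>us vs. Vector_Spaces.linear sc sc' (\<lambda>x. h (us @ x # vs)))"
  using assms unfolding multilinear_fun_def Vector_Spaces.linear_iff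
  by auto

definition symmetric_fun :: "('v list \<Rightarrow> 'u) \<Rightarrow> bool" where
  "symmetric_fun h \<longleftrightarrow> (\<forall>xs ys. mset xs = mset ys \<longrightarrow> h xs = h ys)"

text \<open>Well-definedness on the quotient becomes linearity in each slot of a word, where the
  closure rules for linear maps apply.\<close>

lemma multilinear_relations_vanish:
  assumes "vector_space sc'"
  shows "(\<forall>r\<in>multilinear_relations sc. lin_ext sc' h r = 0) \<longleftrightarrow> multilinear_fun sc sc' h"
proof -
  interpret vector_space sc' by fact
  note l = linear_lin_ext[of h] note s = lin_ext_single[OF assms]
  have 1: "lin_ext sc' h (Poly_Mapping.single p 1 - Poly_Mapping.single q 1 - Poly_Mapping.single r 1)
      = h p - h q - h r" for p q r
    by (simp add: linearD[OF l] s)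
  have 2: "lin_ext sc' h (Poly_Mapping.single p 1 - Poly_Mapping.single q c)
      = h p - sc' c (h q)" for p q c
    by (simp add: linearD[OF l] s)
  have "(\<forall>r\<in>multilinear_relations sc. lin_ext sc' h r = 0) \<longleftrightarrow>
    (\<forall>us x y vs. lin_ext sc' h (Poly_Mapping.single (us @ (x + y) # vs) 1
        - Poly_Mapping.single (us @ x # vs) 1 - Poly_Mapping.single (us @ y # vs) 1) = 0) \<and>
    (\<forall>us c x vs. lin_ext sc' h (Poly_Mapping.single (us @ sc c x # vs) 1
        - Poly_Mapping.single (us @ x # vs) c) = 0)"
proof -
    have *: "(\<forall>r\<in>{f us x y vs | us vs x y. True}. P r) \<longleftrightarrow> (\<forall>us x y vs. P (f us x y vs))"
      for f :: "_ \<Rightarrow> _ \<Rightarrow> _ \<Rightarrow> _ \<Rightarrow> _" and P by blast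
    have **: "(\<forall>r\<in>{f us c x vs | us vs c x. True}. P r) \<longleftrightarrow> (\<forall>us c x vs. P (f us c x vs))"
      for f :: "_ \<Rightarrow> _ \<Rightarrow> _ \<Rightarrow> _ \<Rightarrow> _" and P by blast
    show ?thesis unfolding multilinear_relations_def ball_Un 
      by (intro arg_cong2[where f = "(\<and>)"] * **)
  qed
  then show ?thesis unfolding 1 2 multilinear_fun_def
    by (simp add: algebra_simps)
qed

lemma commutation_relations_vanish:
  assumes "vector_space sc'"
  shows "(\<forall>r\<in>commutation_relations. lin_ext sc' h r = 0) \<longleftrightarrow> symmetric_fun h"
proof -
  interpret vector_space sc' by fact
  note l = linear_lin_ext[of h] note s = lin_ext_single[OF assms]
  have "lin_ext sc' h (Poly_Mapping.single xs 1 - Poly_Mapping.single ys 1) = h xs - h ys" for xs ys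
    by (simp add: linearD[OF l] s)
  then have *: "(\<forall>xs ys. mset xs = mset ys \<longrightarrow>
      lin_ext sc' h (Poly_Mapping.single xs 1 - Poly_Mapping.single ys 1) = 0) \<longleftrightarrow> symmetric_fun h"
    by (simp add: symmetric_fun_def)
  have "(\<forall>r\<in>{f xs ys | xs ys. Q xs ys}. P r) \<longleftrightarrow> (\<forall>xs ys. Q xs ys \<longrightarrow> P (f xs ys))"
    for f :: "_ \<Rightarrow> _ \<Rightarrow> _" and P Q by blast
  from this[of _ _ "\<lambda>r. lin_ext sc' h r = 0"] show ?thesis
    unfolding commutation_relations_def *[symmetric] .
qed

lemma presents_lin_ext_eq_0:
  assumes "presents sc gen R" "r \<in> R"
  shows "lin_ext sc gen r = 0"
proof -
  interpret vector_space fscale by (rule vector_space_fscale)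
  have "r \<in> span R" using assms(2) by (rule span_base)
  then show ?thesis using assms(1) by (auto simp: presents_def)
qed

section \<open>The shuffle algebra\<close>

lemma word_Nil [simp]: "word \<iota> [] = 1"
  and word_Cons [simp]: "word \<iota> (x # xs) = \<iota> x * word \<iota> xs"
  by (simp_all add: word_def)

lemma shuffle_words_Nil2 [simp]: "shuffle_words \<iota> xs [] = word \<iota> xs"
  by (cases xs) auto

lemma shuffle_words_commute: "shuffle_words \<iota> xs ys = shuffle_words \<iota> ys xs"
  by (induction \<iota> xs ys rule: shuffle_words.induct) (auto simp: add.commute)

lemma is_algebra_linear_mult:
  assumes "is_algebra sc"
  shows "Vector_Spaces.linear sc sc ((*) x)" "Vector_Spaces.linear sc sc (\<lambda>y. y * x)"
  using assms unfolding is_algebra_def Vector_Spaces.linear_iff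
  by (auto simp: algebra_simps) metis+

locale shuffle_algebra =
  fixes scV :: "'k::field \<Rightarrow> 'v::ab_group_add \<Rightarrow> 'v"
    and scT :: "'k \<Rightarrow> 't::ring_1 \<Rightarrow> 't"
    and \<iota> :: "'v \<Rightarrow> 't"
  assumes vsV: "vector_space scV" and tensor: "is_tensor_algebra scV scT \<iota>"
begin

lemma algT: "is_algebra scT"
  and presT: "presents scT (word \<iota>) (multilinear_relations scV)"
  using tensor by (auto simp: is_tensor_algebra_def)

lemma vsT: "vector_space scT"
  using algT by (simp add: is_algebra_def)

lemmas lin_mult = is_algebra_linear_mult[OF algT]

abbreviation linT :: "('t \<Rightarrow> 't) \<Rightarrow> bool" where
  "linT \<equiv> Vector_Spaces.linear scT scT"

lemma linear_id: "linT (\<lambda>t. t)"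
  using vsT by (simp add: Vector_Spaces.linear_iff)

lemma multilinear_word: "multilinear_fun scV scT (word \<iota>)"
  using presents_lin_ext_eq_0[OF presT] multilinear_relations_vanish[OF vsT, of scV] by blast

lemma linear_\<iota>: "Vector_Spaces.linear scV scT \<iota>"
proof -
  have "Vector_Spaces.linear scV scT (\<lambda>x. word \<iota> ([] @ x # []))"
    using multilinear_word multilinear_fun_iff_linear[OF vsV vsT] by blast
  then show ?thesis by simp
qed

lemma lin_eqI:
  assumes "Vector_Spaces.linear scT sc f" "Vector_Spaces.linear scT sc g"
    and "\<And>xs. f (word \<iota> xs) = g (word \<iota> xs)"
  shows "f w = g w"
  using presents_linear_eqI[OF presT assms] .

lemma induced_word:
  assumes "vector_space sc" "multilinear_fun scV sc h"
  shows "induced scT (word \<iota>) sc h (word \<iota> xs) = h xs"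
    and "Vector_Spaces.linear scT sc (induced scT (word \<iota>) sc h)"
  using induced_gen[OF presT assms(1)] linear_induced[OF presT assms(1)]
    multilinear_relations_vanish[OF assms(1), of scV] assms(2) by blast+

text \<open>The slot is placed in the right word; the left word then follows by commutativity. The
  recursion may consume letters of either word before it reaches \<open>v\<close>, hence an
  induction on \<open>xs\<close> with \<open>us\<close> general and, inside it, one on
  \<open>us\<close>.\<close>

lemma linear_shuffle_words:
  "Vector_Spaces.linear scV scT (\<lambda>v. shuffle_words \<iota> xs (us @ v # vs))"
proof (induction xs arbitrary: us)
  case Nil
  show ?case using multilinear_word multilinear_fun_iff_linear[OF vsV vsT, of "word \<iota>"]
    by simp
next
  case (Cons x xs)
  note IH = Cons
  show ?case
  proof (induction us)
    case Nil
    show ?case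
      using linear_add_fun[OF linear_comp_fun[OF lin_mult(1) IH[of "[]"], of "\<iota> x"]
          linear_comp_fun[OF lin_mult(2) linear_\<iota>, of "shuffle_words \<iota> (x # xs) vs"]]
      by simp
  next
    case (Cons u us)
    show ?case
      using linear_add_fun[OF linear_comp_fun[OF lin_mult(1) IH[of "u # us"], of "\<iota> x"]
          linear_comp_fun[OF lin_mult(1) Cons, of "\<iota> u"]]
      by simp
  qed
qed

lemma multilinear_shuffle_words:
  "multilinear_fun scV scT (shuffle_words \<iota> xs)"
  "multilinear_fun scV scT (\<lambda>xs. shuffle_words \<iota> xs ys)"
  unfolding multilinear_fun_iff_linear[OF vsV vsT]
  by (simp_all add: linear_shuffle_words shuffle_words_commute[of _ _ ys])

abbreviation sh :: "'t \<Rightarrow> 't \<Rightarrow> 't" where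
  "sh \<equiv> shuffle scT \<iota>"

lemma shuffle_word: "sh (word \<iota> xs) (word \<iota> ys) = shuffle_words \<iota> xs ys"
  and linear_shuffle_left: "linT (\<lambda>f. sh f g)"
  and linear_shuffle_right: "linT (sh f)"
  using multilinear_shuffle_words[folded multilinear_relations_vanish[OF vsT]]
    induced_induced[OF presT vsT, of "shuffle_words \<iota>"]
  unfolding shuffle_def[abs_def] by blast+

lemma shuffle_commute: "sh f g = sh g f"
proof (rule lin_eqI[OF linear_shuffle_left linear_shuffle_right])
  show "sh (word \<iota> xs) g = sh g (word \<iota> xs)" for xs
    by (rule lin_eqI[OF linear_shuffle_right linear_shuffle_left])
      (simp add: shuffle_word shuffle_words_commute)
qed

lemma shuffle_1 [simp]: "sh 1 f = f" "sh f 1 = f"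
proof -
  show "sh 1 f = f"
    by (rule lin_eqI[OF linear_shuffle_right linear_id])
      (use shuffle_word[of "[]"] in simp)
  then show "sh f 1 = f" by (simp add: shuffle_commute)
qed

text \<open>The recursion is extended from words to all of T(V) by linearity, since it is needed for
  arguments that are not words, such as the inner shuffles in the associativity proof.\<close>

lemma shuffle_\<iota>:
  "sh (\<iota> x * f) (\<iota> y * g) = \<iota> x * sh f (\<iota> y * g) + \<iota> y * sh (\<iota> x * f) g"
proof (rule lin_eqI[of scT "\<lambda>f. sh (\<iota> x * f) (\<iota> y * g)" "\<lambda>f. \<iota> x * sh f (\<iota> y * g) + \<iota> y * sh (\<iota> x * f) g"])
  show "linT (\<lambda>f. sh (\<iota> x * f) (\<iota> y * g))"
    by (rule linear_comp_fun[OF linear_shuffle_left lin_mult(1)])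
  show "linT (\<lambda>f. \<iota> x * sh f (\<iota> y * g) + \<iota> y * sh (\<iota> x * f) g)"
    by (intro linear_add_fun linear_comp_fun[OF lin_mult(1)]
        linear_comp_fun[OF linear_shuffle_left lin_mult(1)] linear_shuffle_left)
  fix xs
  show "sh (\<iota> x * word \<iota> xs) (\<iota> y * g) = \<iota> x * sh (word \<iota> xs) (\<iota> y * g) + \<iota> y * sh (\<iota> x * word \<iota> xs) g"
  proof (rule lin_eqI[of scT "\<lambda>g. sh (\<iota> x * word \<iota> xs) (\<iota> y * g)"])
    show "linT (\<lambda>g. sh (\<iota> x * word \<iota> xs) (\<iota> y * g))"
      by (rule linear_comp_fun[OF linear_shuffle_right lin_mult(1)])
    show "linT (\<lambda>g. \<iota> x * sh (word \<iota> xs) (\<iota> y * g) + \<iota> y * sh (\<iota> x * word \<iota> xs) g)"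
      by (intro linear_add_fun linear_comp_fun[OF lin_mult(1)]
          linear_comp_fun[OF linear_shuffle_right lin_mult(1)] linear_shuffle_right)
    fix ys
    show "sh (\<iota> x * word \<iota> xs) (\<iota> y * word \<iota> ys) =
        \<iota> x * sh (word \<iota> xs) (\<iota> y * word \<iota> ys) + \<iota> y * sh (\<iota> x * word \<iota> xs) (word \<iota> ys)"
      using shuffle_words.simps(3)[of \<iota> x xs y ys] unfolding shuffle_word[symmetric] by simp
  qed
qed

text \<open>Both bracketings expand into three terms according to which of \<open>x\<close>,
  \<open>y\<close>, \<open>z\<close> becomes the first letter, and each term has smaller total
  length.\<close>

lemma shuffle_assoc_words:
  "sh (sh (word \<iota> xs) (word \<iota> ys)) (word \<iota> zs) = sh (word \<iota> xs) (sh (word \<iota> ys) (word \<iota> zs))"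
proof (induction "length xs + length ys + length zs" arbitrary: xs ys zs rule: less_induct)
  case less
  show ?case
  proof (cases "xs = [] \<or> ys = [] \<or> zs = []")
    case True
    then show ?thesis by auto
  next
    case False
    then obtain x xs' y ys' z zs' where eq: "xs = x # xs'" "ys = y # ys'" "zs = z # zs'"
      by (meson neq_Nil_conv)
    note IH = less[of xs' ys zs] less[of xs ys' zs] less[of xs ys zs']
    note l = linearD(1)[OF linear_shuffle_left] linearD(1)[OF linear_shuffle_right]
    have 1: "sh (sh (word \<iota> xs) (word \<iota> ys)) (word \<iota> zs) =
      \<iota> x * sh (sh (word \<iota> xs') (word \<iota> ys)) (word \<iota> zs) +
      \<iota> y * sh (sh (word \<iota> xs) (word \<iota> ys')) (word \<iota> zs) +
      \<iota> z * sh (sh (word \<iota> xs) (word \<iota> ys)) (word \<iota> zs')"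
      by (simp add: eq shuffle_\<iota> l algebra_simps)
    have 2: "sh (word \<iota> xs) (sh (word \<iota> ys) (word \<iota> zs)) =
      \<iota> x * sh (word \<iota> xs') (sh (word \<iota> ys) (word \<iota> zs)) +
      \<iota> y * sh (word \<iota> xs) (sh (word \<iota> ys') (word \<iota> zs)) +
      \<iota> z * sh (word \<iota> xs) (sh (word \<iota> ys) (word \<iota> zs'))"
      by (simp add: eq shuffle_\<iota> l algebra_simps)
    show ?thesis unfolding 1 2 using IH by (simp add: eq)
  qed
qed

lemma shuffle_assoc: "sh (sh f g) h = sh f (sh g h)"
proof (rule lin_eqI[OF linear_comp_fun[OF linear_shuffle_left linear_shuffle_left] linear_shuffle_left])
  fix xs
  show "sh (sh (word \<iota> xs) g) h = sh (word \<iota> xs) (sh g h)"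
  proof (rule lin_eqI[OF linear_comp_fun[OF linear_shuffle_left linear_shuffle_right]
        linear_comp_fun[OF linear_shuffle_right linear_shuffle_left]])
    fix ys
    show "sh (sh (word \<iota> xs) (word \<iota> ys)) h = sh (word \<iota> xs) (sh (word \<iota> ys) h)"
      by (rule lin_eqI[OF linear_shuffle_right
        linear_comp_fun[OF linear_shuffle_right linear_shuffle_right]]) (rule shuffle_assoc_words)
  qed
qed

end

section \<open>The operations on T(V)^N: associativity and the Leibniz rule\<close>

locale star_product = shuffle_algebra scV scT \<iota>
  for scV :: "'k::field \<Rightarrow> 'v::ab_group_add \<Rightarrow> 'v"
    and scT :: "'k \<Rightarrow> 't::ring_1 \<Rightarrow> 't"
    and \<iota> :: "'v \<Rightarrow> 't" +
  fixes F :: "'n::finite \<Rightarrow> 'v \<Rightarrow> 'v" and a :: "'k ^ 'n"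
  assumes linear_F: "\<And>i. Vector_Spaces.linear scV scV (F i)"
begin

abbreviation D :: "'n \<Rightarrow> 't \<Rightarrow> 't \<Rightarrow> 't" where
  "D l g \<equiv> induced scT (word \<iota>) scT (star_word scT \<iota> F l g)"

lemma multilinear_star_word: "multilinear_fun scV scT (star_word scT \<iota> F l g)"
  unfolding multilinear_fun_iff_linear[OF vsV vsT]
proof (intro allI)
  fix us vs
  show "Vector_Spaces.linear scV scT (\<lambda>x. star_word scT \<iota> F l g (us @ x # vs))"
  proof (induction us)
    case Nil
    show ?case
      unfolding append_Nil star_word.simps
      by (intro linear_add_fun linear_comp_fun[OF lin_mult(2) linear_\<iota>]
          linear_comp_fun[OF lin_mult(2) linear_comp_fun[OF linear_\<iota> linear_F]])
  next
    case (Cons u us)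
    have "Vector_Spaces.linear scV scT (\<lambda>x. word \<iota> (us @ x # vs))"
      using multilinear_word multilinear_fun_iff_linear[OF vsV vsT] by blast
    from linear_add_fun[OF linear_comp_fun[OF lin_mult(1) Cons] 
          linear_comp_fun[OF lin_mult(1) linear_comp_fun[OF linear_shuffle_left this]]]
    show ?case
      unfolding append_Cons star_word.simps .
  qed
qed

lemma linear_D: "linT (D l g)"
  by (rule induced_word[OF vsT multilinear_star_word])

lemma D_1: "D l g 1 = 0"
  using induced_word(1)[OF vsT multilinear_star_word, of l g "[]"] by simp

lemma D_\<iota>: "D l g (\<iota> x * f) = \<iota> x * D l g f + \<iota> (F l x) * sh f g"
proof (rule lin_eqI[of scT "\<lambda>f. D l g (\<iota> x * f)"])
  show "linT (\<lambda>f. D l g (\<iota> x * f))"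
    by (rule linear_comp_fun[OF linear_D lin_mult(1)])
  show "linT (\<lambda>f. \<iota> x * D l g f + \<iota> (F l x) * sh f g)"
    by (intro linear_add_fun linear_comp_fun[OF lin_mult(1)] linear_shuffle_left linear_D)
  show "D l g (\<iota> x * word \<iota> xs) = \<iota> x * D l g (word \<iota> xs) + \<iota> (F l x) * sh (word \<iota> xs) g" for xs
    using induced_word(1)[OF vsT multilinear_star_word, of l g "x # xs"]
      induced_word(1)[OF vsT multilinear_star_word, of l g xs] by simp
qed

text \<open>By its recursion, \<open>D l g\<close> lets one letter x become F_l(x) and shuffles what
  follows with \<open>g\<close>. The first letter of a shuffle comes from one of the two words, and
  shuffling \<open>g\<close> into the remainder is shuffling it into the rest of that word, so the
  rule descends to shorter words.\<close>

lemma D_shuffle_words: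
  "D l g (sh (word \<iota> xs) (word \<iota> ys)) = sh (D l g (word \<iota> xs)) (word \<iota> ys) + sh (word \<iota> xs) (D l g (word \<iota> ys))"
proof (induction "length xs + length ys" arbitrary: xs ys rule: less_induct)
  case less
  show ?case
  proof (cases "xs = [] \<or> ys = []")
    case True
    then show ?thesis 
      by (auto simp: D_1 linearD(4)[OF linear_shuffle_left] linearD(4)[OF linear_shuffle_right])
  next
    case False
    then obtain x xs' y ys' where eq: "xs = x # xs'" "ys = y # ys'"
      by (meson neq_Nil_conv)
    note l = linearD(1)[OF linear_shuffle_left] linearD(1)[OF linear_shuffle_right] linearD(1)[OF linear_D]
    let ?X = "word \<iota> xs'" and ?Y = "word \<iota> ys'"
    \<comment> \<open>\<open>g\<close> is moved onto the word whose first letter was taken.\<close>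
    have 1: "sh (sh ?X (\<iota> y * ?Y)) g = sh (sh ?X g) (\<iota> y * ?Y)"
      "sh (sh (\<iota> x * ?X) ?Y) g = sh (\<iota> x * ?X) (sh ?Y g)"
      by (metis shuffle_assoc shuffle_commute)+
    have 2: "D l g (sh ?X (\<iota> y * ?Y)) = sh (D l g ?X) (\<iota> y * ?Y) + sh ?X (D l g (\<iota> y * ?Y))"
      using less[of xs' ys] by (simp add: eq)
    have 3: "D l g (sh (\<iota> x * ?X) ?Y) = sh (D l g (\<iota> x * ?X)) ?Y + sh (\<iota> x * ?X) (D l g ?Y)"
      using less[of xs ys'] by (simp add: eq)
    show ?thesis
      unfolding eq word_Cons shuffle_\<iota> l(3) D_\<iota> 1 2 3 l 
      by (simp add: algebra_simps)
  qed
qed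

lemma D_shuffle: "D l g (sh f h) = sh (D l g f) h + sh f (D l g h)"
proof (rule lin_eqI[of scT "\<lambda>f. D l g (sh f h)"])
  show "linT (\<lambda>f. D l g (sh f h))"
    by (rule linear_comp_fun[OF linear_D linear_shuffle_left])
  show "linT (\<lambda>f. sh (D l g f) h + sh f (D l g h))"
    by (intro linear_add_fun linear_comp_fun[OF linear_shuffle_left] linear_shuffle_left linear_D)
  show "D l g (sh (word \<iota> xs) h) = sh (D l g (word \<iota> xs)) h + sh (word \<iota> xs) (D l g h)" for xs
    by (rule lin_eqI[OF linear_comp_fun[OF linear_D linear_shuffle_right]
        linear_add_fun[OF linear_shuffle_right linear_comp_fun[OF linear_shuffle_right linear_D]]])
      (rule D_shuffle_words)
qed

text \<open>The form sending f \<epsilon>_i to a_i f. Through it, left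
  \<open>ash\<close>-multiplication by \<open>u\<close> is the shuffle of every coordinate with one
  fixed element of T(V).\<close>

definition functional :: "'t ^ 'n \<Rightarrow> 't" where
  "functional u = (\<Sum>i\<in>UNIV. scT (a $ i) (u $ i))"

lemma ash_nth: "ash scT \<iota> a u v $ l = sh (functional u) (v $ l)"
  by (simp add: ash_def functional_def axis_def linearD[OF linear_shuffle_left])

lemma star_nth: "star scT \<iota> F u v $ i = (\<Sum>l\<in>UNIV. D l (v $ l) (u $ i))"
  unfolding star_def by (subst sum.swap) (simp add: axis_def)

lemma functional_ash: "functional (ash scT \<iota> a u v) = sh (functional u) (functional v)"
  by (simp add: functional_def[of v] functional_def[of "ash _ _ _ _ _"] ash_nth
      linearD[OF linear_shuffle_right])

lemma functional_star: "functional (star scT \<iota> F u v) = (\<Sum>l\<in>UNIV. D l (v $ l) (functional u))"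
proof -
  interpret vector_space scT by (rule vsT)
  show ?thesis unfolding functional_def star_nth scale_sum_right
    by (subst sum.swap) (simp add: linearD[OF linear_D])
qed

lemma ash_assoc: "ash scT \<iota> a (ash scT \<iota> a u v) w = ash scT \<iota> a u (ash scT \<iota> a v w)"
  by (simp add: vec_eq_iff ash_nth functional_ash shuffle_assoc)

text \<open>Right \<open>star\<close>-multiplication by \<open>w\<close> acts on all coordinates by
  the same shuffle derivation, the sum of the \<open>D l (w $ l)\<close>, and therefore commutes
  with \<open>functional\<close>; the claim is the Leibniz rule of that derivation.\<close>

lemma star_ash:
  "star scT \<iota> F (ash scT \<iota> a u v) w =
     ash scT \<iota> a (star scT \<iota> F u w) v + ash scT \<iota> a u (star scT \<iota> F v w)"
  by (simp add: vec_eq_iff ash_nth star_nth functional_star D_shuffle sum.distrib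
      linearD[OF linear_shuffle_right] linearD[OF linear_shuffle_left])

lemma vector_space_vscale: "vector_space (vscale scT)"
proof -
  interpret vector_space scT by (rule vsT)
  show ?thesis by unfold_locales (simp_all add: vec_eq_iff vscale_def algebra_simps)
qed

lemma is_bilinear_ash: "is_bilinear (vscale scT) (ash scT \<iota> a)"
proof -
  interpret vector_space scT by (rule vsT)
  have "functional (u + v) = functional u + functional v"
    "functional (vscale scT c u) = scT c (functional u)" for u v c
    by (simp_all add: functional_def vscale_def scale_right_distrib scale_sum_right 
        mult.commute sum.distrib)
  then show ?thesis
    using vector_space_vscale
    by (simp add: is_bilinear_def Vector_Spaces.linear_iff vec_eq_iff ash_nth vscale_def
        linearD[OF linear_shuffle_right] linearD[OF linear_shuffle_left])
qed

end

section \<open>The symmetric algebra and its second product\<close>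

text \<open>The pairs \<open>(I, \<theta>)\<close> in \<open>btl_words\<close> are the matchings \<open>{(\<theta> i, i) | i \<in> I}\<close>; in this form
  the sum is visibly symmetric under exchanging the two words.\<close>

definition matchings :: "'a set \<Rightarrow> 'b set \<Rightarrow> ('a \<times> 'b) set set" where
  "matchings A B = {M. M \<subseteq> A \<times> B \<and> inj_on fst M \<and> inj_on snd M}"

definition matching_term ::
  "('g \<Rightarrow> 's::comm_ring_1) \<Rightarrow> ('g \<Rightarrow> 'g \<Rightarrow> 'g) \<Rightarrow> 'g list \<Rightarrow> 'g list \<Rightarrow> (nat \<times> nat) set \<Rightarrow> 's" where
  "matching_term j m xs ys M =
     (\<Prod>i\<in>{..<length xs} - fst ` M. j (xs ! i)) *
     (\<Prod>i\<in>{..<length ys} - snd ` M. j (ys ! i)) *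
     (\<Prod>e\<in>M. j (m (xs ! fst e) (ys ! snd e)))"

lemma btl_words_matchings:
  "btl_words j m xs ys = (\<Sum>M\<in>matchings {..<length xs} {..<length ys}. matching_term j m xs ys M)"
proof -
  let ?A = "{..<length xs}" and ?B = "{..<length ys}"
  have fin: "finite {\<theta> \<in> I \<rightarrow>\<^sub>E ?A. inj_on \<theta> I}" if "I \<in> Pow ?B" for I
  proof -
    have "finite (I \<rightarrow>\<^sub>E ?A)" using that finite_subset[of I ?B] by (intro finite_PiE) auto
    then show ?thesis by simp
  qed
  have "btl_words j m xs ys = (\<Sum>(I, \<theta>)\<in>(SIGMA I:Pow ?B. {\<theta> \<in> I \<rightarrow>\<^sub>E ?A. inj_on \<theta> I}).
        (\<Prod>i\<in>?A - \<theta> ` I. j (xs ! i)) * (\<Prod>i\<in>?B - I. j (ys ! i)) *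
        (\<Prod>i\<in>I. j (m (xs ! \<theta> i) (ys ! i))))"
    unfolding btl_words_def using fin by (subst sum.Sigma) auto
  also have "\<dots> = (\<Sum>M\<in>matchings ?A ?B. matching_term j m xs ys M)"
  \<comment> \<open>A pair goes to the transposed graph of \<open>\<theta>\<close>. Going back, the
    second projection is inverted on \<open>M\<close>; the restricted lambda makes the result
    extensional, as \<open>\<rightarrow>\<^sub>E\<close> demands.\<close>
  proof (rule sum.reindex_bij_witness[where
        i = "\<lambda>M. (snd ` M, \<lambda>q\<in>snd ` M. fst (inv_into M snd q))" and
        j = "\<lambda>(I, \<theta>). (\<lambda>q. (\<theta> q, q)) ` I"], goal_cases)
    case (1 x)
    then obtain I \<theta> where x: "x = (I, \<theta>)" and \<theta>: "\<theta> \<in> I \<rightarrow>\<^sub>E ?A" by auto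
    have inj: "inj_on snd ((\<lambda>q. (\<theta> q, q)) ` I)" by (auto simp: inj_on_def)
    have "inv_into ((\<lambda>q. (\<theta> q, q)) ` I) snd q = (\<theta> q, q)" if "q \<in> I" for q
      using inv_into_f_f[OF inj, of "(\<theta> q, q)"] that by auto
    moreover have "snd ` (\<lambda>q. (\<theta> q, q)) ` I = I" by force
    ultimately show ?case using \<theta> by (auto simp: x fun_eq_iff PiE_def extensional_def)
  next
    case (2 x)
    then show ?case by (auto simp: matchings_def inj_on_def PiE_def)
  next
    case (3 M)
    then have inj: "inj_on snd M" by (simp add: matchings_def)
    have "(fst (inv_into M snd (snd e)), snd e) = e" if "e \<in> M" for e
      using inv_into_f_f[OF inj that] by simp
    then show ?case by (force simp: image_image)
  next
    case (4 M)
    then have M: "M \<subseteq> ?A \<times> ?B" "inj_on fst M" "inj_on snd M" by (auto simp: matchings_def)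
    have "fst (inv_into M snd (snd e)) = fst e" if "e \<in> M" for e
      using inv_into_f_f[OF M(3) that] by simp
    then have *: "(\<lambda>q\<in>snd ` M. fst (inv_into M snd q)) (snd e) = fst e" if "e \<in> M" for e
      using that by simp
    have "(\<lambda>q\<in>snd ` M. fst (inv_into M snd q)) \<in> snd ` M \<rightarrow>\<^sub>E ?A"
      using M(1) * by (intro PiE_I) auto
    moreover have "inj_on (\<lambda>q\<in>snd ` M. fst (inv_into M snd q)) (snd ` M)"
      by (intro inj_onI) (metis (no_types, lifting) * M(2) imageE inj_onD)
    moreover have "snd ` M \<subseteq> ?B" using M(1) by auto
    ultimately show ?case by simp
  next
    case (5 x)
    then obtain I \<theta> where x: "x = (I, \<theta>)" by auto
    have "fst ` (\<lambda>q. (\<theta> q, q)) ` I = \<theta> ` I" "snd ` (\<lambda>q. (\<theta> q, q)) ` I = I"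
      by (auto simp: image_image)
    then show ?case unfolding x
      by (simp add: matching_term_def prod.reindex inj_on_def)
  qed
  finally show ?thesis .
qed

text \<open>Transposing the matchings lets properties in the left word be deduced from those in the
  right word for the opposite of \<open>m\<close>.\<close>

lemma btl_words_flip: "btl_words j (\<lambda>x y. m y x) xs ys = btl_words j m ys xs"
  unfolding btl_words_matchings
proof (rule sum.reindex_bij_witness[where i = "image prod.swap" and j = "image prod.swap"], goal_cases)
  case (5 M)
  then show ?case
    by (simp add: matching_term_def image_image prod.reindex mult_ac)
qed (auto simp: matchings_def image_image inj_on_def)

lemma matchings_image:
  assumes "M \<in> matchings A B" "g \<in> B \<rightarrow> C" "inj_on g B"
  shows "map_prod id g ` M \<in> matchings A C"
proof -
  have M: "M \<subseteq> A \<times> B" "inj_on fst M" "inj_on snd M"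
    using assms(1) by (auto simp: matchings_def)
  have "inj_on fst (map_prod id g ` M)"
    by (rule inj_on_imageI) (use M(2) in \<open>simp add: inj_on_def\<close>)
  moreover have "inj_on (g \<circ> snd) M"
    using M by (intro comp_inj_on inj_on_subset[OF assms(3)]) auto
  then have "inj_on snd (map_prod id g ` M)"
    by (intro inj_on_imageI) (simp add: inj_on_def)
  ultimately show ?thesis
    using M(1) assms(2) by (auto simp: matchings_def)
qed

lemma mset_eq_bij:
  assumes "mset xs = mset ys"
  obtains f where "bij_betw f {..<length xs} {..<length ys}" "\<And>i. i < length xs \<Longrightarrow> xs ! i = ys ! f i"
  using permutation_Ex_bij[of xs ys] assms by auto

text \<open>A bijection of positions relabels the right endpoints of the matchings and leaves every
  term unchanged.\<close>

lemma symmetric_fun_btl_words_right: "symmetric_fun (btl_words j m xs)"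
  unfolding symmetric_fun_def
proof (intro allI impI)
  fix ys zs :: "'a list"
  assume "mset ys = mset zs"
  then obtain f where f: "bij_betw f {..<length ys} {..<length zs}"
    "\<And>i. i < length ys \<Longrightarrow> ys ! i = zs ! f i"
    by (rule mset_eq_bij) blast
  let ?A = "{..<length xs}" and ?B = "{..<length ys}" and ?C = "{..<length zs}"
  let ?h = "inv_into ?B f"
  have h: "?h \<in> ?C \<rightarrow> ?B" "\<And>i. i \<in> ?C \<Longrightarrow> f (?h i) = i" "\<And>i. i \<in> ?B \<Longrightarrow> ?h (f i) = i" "f \<in> ?B \<rightarrow> ?C"
    using f(1) bij_betw_inv_into[OF f(1)] bij_betw_inv_into_left[OF f(1)]
      bij_betw_inv_into_right[OF f(1)] by (auto simp: bij_betw_def)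
  have injf: "inj_on f ?B" and imf: "f ` ?B = ?C" using f(1) by (auto simp: bij_betw_def)
  show "btl_words j m xs ys = btl_words j m xs zs"
    unfolding btl_words_matchings
  proof (rule sum.reindex_bij_witness[where i = "image (map_prod id ?h)" and j = "image (map_prod id f)"], goal_cases)
    case (1 M)
    then have "\<And>e. e \<in> M \<Longrightarrow> snd e \<in> ?B" by (auto simp: matchings_def)
    then show ?case by (force simp: image_image h)
  next
    case (2 M)
    then show ?case using h(4) injf by (rule matchings_image)
  next
    case (3 M)
    then have "\<And>e. e \<in> M \<Longrightarrow> snd e \<in> ?C" by (auto simp: matchings_def)
    then show ?case by (force simp: image_image h)
  next
    case (4 M)
    have injh: "inj_on ?h ?C" using bij_betw_inv_into[OF f(1)] by (auto simp: bij_betw_def)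
    show ?case using 4 h(1) injh by (rule matchings_image)
  next
    case (5 M)
    then have M: "M \<subseteq> ?A \<times> ?B" "inj_on fst M" "inj_on snd M" by (auto simp: matchings_def)
    have "inj_on (map_prod id f) (?A \<times> ?B)"
      by (intro map_prod_inj_on injf inj_on_id)
    then have "inj_on (map_prod id f) M"
      using M(1) by (rule inj_on_subset)
    then have 1: "(\<Prod>e\<in>map_prod id f ` M. j (m (xs ! fst e) (zs ! snd e))) =
        (\<Prod>e\<in>M. j (m (xs ! fst e) (ys ! snd e)))"
      using M(1) f(2) by (subst prod.reindex) (auto intro!: prod.cong)
    have "snd ` map_prod id f ` M = f ` snd ` M" by (simp add: image_image)
    moreover have "snd ` M \<subseteq> ?B" using M(1) by auto
    ultimately have "?C - snd ` map_prod id f ` M = f ` (?B - snd ` M)"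
      using inj_on_image_set_diff[OF injf, of ?B "snd ` M"] imf by auto
    then have 2: "(\<Prod>i\<in>?C - snd ` map_prod id f ` M. j (zs ! i)) = (\<Prod>i\<in>?B - snd ` M. j (ys ! i))"
      using inj_on_subset[OF injf, of "?B - snd ` M"] f(2)
      by (auto simp: prod.reindex intro!: prod.cong)
    have "fst ` map_prod id f ` M = fst ` M" by (simp add: image_image)
    then show ?case unfolding matching_term_def 1 2 by simp
  qed
qed

lemma nth_middle_other: "i \<noteq> length us \<Longrightarrow> (us @ x # vs) ! i = (us @ y # vs) ! i"
  by (auto simp: nth_append nth_Cons')

lemma prod_word: "word j xs = (\<Prod>i<length xs. j (xs ! i))" for j :: "_ \<Rightarrow> 's::comm_ring_1"
  by (induction xs) (simp_all add: prod.lessThan_Suc_shift del: prod.lessThan_Suc)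

section \<open>Maps defined on the symmetric algebra: counit, coproduct, second product\<close>

locale symmetric_algebra =
  fixes scG :: "'k::field \<Rightarrow> 'g::ab_group_add \<Rightarrow> 'g"
    and scS :: "'k \<Rightarrow> 's::comm_ring_1 \<Rightarrow> 's"
    and j :: "'g \<Rightarrow> 's"
  assumes vsG: "vector_space scG" and sym: "is_symmetric_algebra scG scS j"
begin

lemma algS: "is_algebra scS"
  and presS: "presents scS (word j) (multilinear_relations scG \<union> commutation_relations)"
  using sym by (auto simp: is_symmetric_algebra_def)

lemma vsS: "vector_space scS"
  using algS by (simp add: is_algebra_def)

lemmas lin_mult = is_algebra_linear_mult[OF algS]

abbreviation linS :: "('s \<Rightarrow> 's) \<Rightarrow> bool" where
  "linS \<equiv> Vector_Spaces.linear scS scS"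

lemma relations_vanish:
  assumes "vector_space sc"
  shows "(\<forall>r\<in>multilinear_relations scG \<union> commutation_relations. lin_ext sc h r = 0) \<longleftrightarrow>
    multilinear_fun scG sc h \<and> symmetric_fun h"
  unfolding ball_Un multilinear_relations_vanish[OF assms] commutation_relations_vanish[OF assms] ..

lemma multilinear_word: "multilinear_fun scG scS (word j)"
  using presents_lin_ext_eq_0[OF presS] relations_vanish[OF vsS, of "word j"] by blast

lemma linear_j: "Vector_Spaces.linear scG scS j"
proof -
  have "Vector_Spaces.linear scG scS (\<lambda>x. word j ([] @ x # []))"
    using multilinear_word multilinear_fun_iff_linear[OF vsG vsS] by blast
  then show ?thesis by simp
qed

lemma lin_eqI:
  assumes "Vector_Spaces.linear scS sc f" "Vector_Spaces.linear scS sc g"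
    and "\<And>xs. f (word j xs) = g (word j xs)"
  shows "f w = g w"
  using presents_linear_eqI[OF presS assms] .

lemma induced_word:
  assumes "vector_space sc" "multilinear_fun scG sc h" "symmetric_fun h"
  shows "induced scS (word j) sc h (word j xs) = h xs"
    and "Vector_Spaces.linear scS sc (induced scS (word j) sc h)"
  using induced_gen[OF presS assms(1)] linear_induced[OF presS assms(1)]
    relations_vanish[OF assms(1), of h] assms by blast+

lemma inj_j: "inj j"
proof -
  \<comment> \<open>\<open>h\<close> induces the projection of \<open>S\<close> onto its part of degree one.\<close>
  define h where "h = (\<lambda>xs::'g list. if length xs = 1 then hd xs else 0)"
  interpret vector_space scG by (rule vsG)
  have "multilinear_fun scG scG h"
    unfolding multilinear_fun_def h_def by auto
  moreover have "symmetric_fun h"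
    unfolding symmetric_fun_def h_def
    by (auto simp: length_Suc_conv dest: mset_eq_length)
  ultimately have "induced scS (word j) scG h (word j [x]) = h [x]" for x
    by (rule induced_word(1)[OF vsG])
  then have "induced scS (word j) scG h (j x) = x" for x by (simp add: h_def)
  then show ?thesis by (metis injI)
qed

text \<open>Formulas over words distribute the positions over several products; the varying slot
  enters linearly in the one that contains it, and the others do not see it.\<close>

lemma linear_prod_nth:
  assumes "finite A"
  shows "length us \<in> A \<Longrightarrow> Vector_Spaces.linear scG scS (\<lambda>v. \<Prod>i\<in>A. j ((us @ v # vs) ! i))"
    and "length us \<notin> A \<Longrightarrow> (\<Prod>i\<in>A. j ((us @ v # vs) ! i)) = (\<Prod>i\<in>A. j ((us @ w # vs) ! i))"
proof -
  have *: "(\<Prod>i\<in>A. j ((us @ v # vs) ! i)) = (\<Prod>i\<in>A. j ((us @ w # vs) ! i))"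
    if "length us \<notin> A" for A v w
    using that nth_middle_other[of _ us v vs w] by (intro prod.cong refl arg_cong[of _ _ j]) metis
  show "length us \<notin> A \<Longrightarrow> (\<Prod>i\<in>A. j ((us @ v # vs) ! i)) = (\<Prod>i\<in>A. j ((us @ w # vs) ! i))"
    by (rule *)
  assume "length us \<in> A"
  \<comment> \<open>Position \<open>length us\<close> is removed from the product, so the 0 placed
    there is never read.\<close>
  then have "(\<Prod>i\<in>A. j ((us @ v # vs) ! i)) = j v * (\<Prod>i\<in>A - {length us}. j ((us @ 0 # vs) ! i))" for v
    using * [of "A - {length us}" v 0] by (subst prod.remove[OF assms]) auto
  then show "Vector_Spaces.linear scG scS (\<lambda>v. \<Prod>i\<in>A. j ((us @ v # vs) ! i))"
    by (simp add: linear_comp_fun[OF lin_mult(2) linear_j])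
qed

lemma counit_primitive: "counit scS j (j y) = 0"
proof -
  have vs: "vector_space ((*) :: 'k \<Rightarrow> 'k \<Rightarrow> 'k)"
    by unfold_locales (simp_all add: algebra_simps)
  have "multilinear_fun scG (*) (\<lambda>ys::'g list. if ys = [] then 1 else 0 :: 'k)"
    "symmetric_fun (\<lambda>ys::'g list. if ys = [] then 1 else 0 :: 'k)"
    unfolding multilinear_fun_def symmetric_fun_def by auto
  from induced_word(1)[OF vs this, of "[y]"] show ?thesis by (simp add: counit_def)
qed

text \<open>The value of \<open>coproduct\<close> in the free space on pairs depends on the
  representative chosen for its argument; independence appears after evaluation on a bilinear
  \<open>B\<close>. The work is to show that the evaluated map is multilinear and symmetric in the
  word, before the word is taken to be \<open>[y]\<close>.\<close>

lemma sweedler_coproduct_primitive: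
  assumes B: "is_bilinear scS B"
  shows "sweedler scS B (coproduct scS j (j y)) = B (j y) 1 + B 1 (j y)"
proof -
  define h where "h = (\<lambda>ys. \<Sum>I\<in>Pow {..<length ys}.
          Poly_Mapping.single (\<Prod>i\<in>I. j (ys ! i), \<Prod>i\<in>{..<length ys} - I. j (ys ! i)) (1::'k))"
  define h' where "h' = (\<lambda>ys. \<Sum>I\<in>Pow {..<length ys}.
          B (\<Prod>i\<in>I. j (ys ! i)) (\<Prod>i\<in>{..<length ys} - I. j (ys ! i)))"
  interpret vector_space scS by (rule vsS)
  have l: "Vector_Spaces.linear fscale scS (sweedler scS B)"
    unfolding sweedler_def by (rule linear_lin_ext)
  have "sweedler scS B (h ys) = h' ys" for ys
    unfolding h_def h'_def linearD(6)[OF l] 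
    by (simp add: sweedler_def lin_ext_single[OF vsS])
  \<comment> \<open>Both sides choose the same preimage of \<open>s\<close>, so no compatibility
    with the relations enters yet.\<close>
  then have "sweedler scS B (coproduct scS j s) = induced scS (word j) scS h' s" for s
    unfolding coproduct_def induced_def h_def[symmetric] lin_ext_comp[OF l] by simp
  moreover have "multilinear_fun scG scS h'"
    unfolding multilinear_fun_iff_linear[OF vsG vsS]
  proof (intro allI)
    fix us vs :: "'g list"
    let ?n = "{..<Suc (length us + length vs)}"
    have "Vector_Spaces.linear scG scS (\<lambda>x. B (\<Prod>i\<in>I. j ((us @ x # vs) ! i)) (\<Prod>i\<in>?n - I. j ((us @ x # vs) ! i)))"
      if "I \<in> Pow ?n" for I
    proof (cases "length us \<in> I")
      case True
      define c where "c = (\<Prod>i\<in>?n - I. j ((us @ 0 # vs) ! i))"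
      have c: "(\<Prod>i\<in>?n - I. j ((us @ x # vs) ! i)) = c" for x
        unfolding c_def using True by (intro linear_prod_nth(2)) auto
      have "linS (\<lambda>s. B s c)"
        using B by (simp add: is_bilinear_def)
      moreover have "finite I" using that finite_subset[of I ?n] by auto
      ultimately show ?thesis
        unfolding c by (rule linear_comp_fun[OF _ linear_prod_nth(1)[OF _ True]])
    next
      case False
      define c where "c = (\<Prod>i\<in>I. j ((us @ 0 # vs) ! i))"
      have "finite I" using that finite_subset[of I ?n] by auto
      then have c: "(\<Prod>i\<in>I. j ((us @ x # vs) ! i)) = c" for x
        unfolding c_def using False by (intro linear_prod_nth(2)) auto
      have "linS (B c)"
        using B by (simp add: is_bilinear_def)
      moreover have "finite (?n - I)" "length us \<in> ?n - I" using False by auto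
      ultimately show ?thesis 
        unfolding c by (rule linear_comp_fun[OF _ linear_prod_nth(1)])
    qed
    then show "Vector_Spaces.linear scG scS (\<lambda>x. h' (us @ x # vs))"
      unfolding h'_def length_append list.size add_Suc_right
      by (intro linear_sum_fun[OF vsG vsS]) simp
  qed
  moreover have "symmetric_fun h'"
    unfolding symmetric_fun_def
  proof (intro allI impI)
    fix xs ys :: "'g list"
    assume "mset xs = mset ys"
    then obtain f where f: "bij_betw f {..<length xs} {..<length ys}"
      "\<And>i. i < length xs \<Longrightarrow> xs ! i = ys ! f i"
      by (rule mset_eq_bij) blast
    have injf: "inj_on f {..<length xs}" and imf: "f ` {..<length xs} = {..<length ys}"
      using f(1) by (auto simp: bij_betw_def)
    have p: "(\<Prod>i\<in>I. j (xs ! i)) = (\<Prod>i\<in>f ` I. j (ys ! i))" if "I \<subseteq> {..<length xs}" for I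
      using inj_on_subset[OF injf that] f(2) that by (subst prod.reindex) (auto intro!: prod.cong)
    have bij: "bij_betw (image f) (Pow {..<length xs}) (Pow {..<length ys})"
      using f(1) by (rule bij_betw_Pow)
    have diff: "f ` ({..<length xs} - I) = {..<length ys} - f ` I" if "I \<subseteq> {..<length xs}" for I
      using that injf by (subst inj_on_image_set_diff[of f "{..<length xs}"]) (auto simp: imf)
    have "h' ys = (\<Sum>I\<in>Pow {..<length xs}.
          B (\<Prod>i\<in>f ` I. j (ys ! i)) (\<Prod>i\<in>{..<length ys} - f ` I. j (ys ! i)))"
      unfolding h'_def by (rule sum.reindex_bij_betw[OF bij, symmetric])
    also have "\<dots> = h' xs"
      unfolding h'_def by (intro sum.cong refl) (simp add: p diff[symmetric])
    finally show "h' xs = h' ys" ..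
  qed
  ultimately have "sweedler scS B (coproduct scS j (word j [y])) = h' [y]"
    using induced_word(1)[OF vsS, of h'] by (simp only:)
  moreover have "h' [y] = B 1 (j y) + B (j y) 1"
  proof -
    have "{..<Suc 0} = {0}" by auto
    moreover have "Pow {0::nat} = {{}, {0}}" by auto
    ultimately show ?thesis by (simp add: h'_def)
  qed
  ultimately show ?thesis by (simp add: add.commute)
qed

text \<open>As \<open>snd\<close> is injective on a matching, the slot occurs in exactly one factor:
  as \<open>j v\<close> among the unmatched entries, or as \<open>j (m (xs ! p) v)\<close> for the
  single edge that ends there.\<close>

lemma multilinear_btl_words_right:
  assumes "is_bilinear scG m"
  shows "multilinear_fun scG scS (btl_words j m xs)"
  unfolding multilinear_fun_iff_linear[OF vsG vsS] btl_words_matchings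
proof (intro allI)
  fix us vs :: "'g list"
  let ?n = "{..<Suc (length us + length vs)}"
  have lin: "Vector_Spaces.linear scG scS (\<lambda>v. j (m x v))" for x
    using assms by (intro linear_comp_fun[OF linear_j]) (simp add: is_bilinear_def)
  have "Vector_Spaces.linear scG scS (\<lambda>v. matching_term j m xs (us @ v # vs) M)"
    if M: "M \<in> matchings {..<length xs} ?n" for M
  proof -
    have "finite M"
      using M finite_subset[of M "{..<length xs} \<times> ?n"] by (auto simp: matchings_def)
    have other: "(\<Prod>e\<in>N. j (m (xs ! fst e) ((us @ v # vs) ! snd e))) =
        (\<Prod>e\<in>N. j (m (xs ! fst e) ((us @ 0 # vs) ! snd e)))"
      if "length us \<notin> snd ` N" for N v
      using that nth_middle_other[of _ us v vs 0]
      by (intro prod.cong refl) (metis image_eqI)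
    show ?thesis
    proof (cases "length us \<in> snd ` M")
      case True
      then obtain p where p: "(p, length us) \<in> M" by auto
      have "length us \<notin> snd ` (M - {(p, length us)})"
      proof
        assume "length us \<in> snd ` (M - {(p, length us)})"
        then obtain e where e: "e \<in> M" "e \<noteq> (p, length us)" "snd e = length us" by fastforce
        have "inj_on snd M" using M by (simp add: matchings_def)
        from inj_onD[OF this _ e(1) p] e(2,3) show False by simp
      qed
      then have "matching_term j m xs (us @ v # vs) M =
        (\<Prod>i\<in>{..<length xs} - fst ` M. j (xs ! i)) * (\<Prod>i\<in>?n - snd ` M. j ((us @ 0 # vs) ! i)) *
        (j (m (xs ! p) v) * (\<Prod>e\<in>M - {(p, length us)}. j (m (xs ! fst e) ((us @ 0 # vs) ! snd e))))"
        for v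
        using linear_prod_nth(2)[of "?n - snd ` M" us v vs 0] True
        unfolding matching_term_def
        by (subst prod.remove[OF \<open>finite M\<close> p]) (simp add: other[of _ v])
      then show ?thesis
        by (simp only:) (intro linear_comp_fun[OF lin_mult(1)] linear_comp_fun[OF lin_mult(2)] lin)
    next
      case False
      then have "matching_term j m xs (us @ v # vs) M =
        (\<Prod>i\<in>{..<length xs} - fst ` M. j (xs ! i)) * (\<Prod>i\<in>?n - snd ` M. j ((us @ v # vs) ! i)) *
        (\<Prod>e\<in>M. j (m (xs ! fst e) ((us @ 0 # vs) ! snd e)))" for v
        unfolding matching_term_def by (simp add: other[of _ v])
      moreover have "Vector_Spaces.linear scG scS (\<lambda>v. \<Prod>i\<in>?n - snd ` M. j ((us @ v # vs) ! i))"
        using False by (intro linear_prod_nth(1)) auto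
      ultimately show ?thesis
        by (simp only:) (intro linear_comp_fun[OF lin_mult(2)] linear_comp_fun[OF lin_mult(1)])
    qed
  qed
  then show "Vector_Spaces.linear scG scS (\<lambda>v. \<Sum>M\<in>matchings {..<length xs} {..<length (us @ v # vs)}.
      matching_term j m xs (us @ v # vs) M)"
    unfolding length_append list.size add_Suc_right
    by (intro linear_sum_fun[OF vsG vsS]) simp
qed

lemma btl_words_vanish:
  assumes m: "is_bilinear scG m"
  defines "R \<equiv> multilinear_relations scG \<union> commutation_relations"
  shows "\<forall>r\<in>R. lin_ext scS (btl_words j m xs) r = 0"
    and "\<forall>r\<in>R. lin_ext scS (\<lambda>xs. btl_words j m xs ys) r = 0"
proof -
  have "is_bilinear scG (\<lambda>x y. m y x)" using m by (simp add: is_bilinear_def)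
  then show "\<forall>r\<in>R. lin_ext scS (\<lambda>xs. btl_words j m xs ys) r = 0"
    using multilinear_btl_words_right symmetric_fun_btl_words_right
    unfolding btl_words_flip[of j m, symmetric] R_def relations_vanish[OF vsS] by blast
  show "\<forall>r\<in>R. lin_ext scS (btl_words j m xs) r = 0"
    using multilinear_btl_words_right[OF m] symmetric_fun_btl_words_right
    unfolding R_def relations_vanish[OF vsS] by blast
qed

end

section \<open>The operators M v and derivations of the commutative product\<close>

locale symmetric_algebra_product = symmetric_algebra scG scS j
  for scG :: "'k::field \<Rightarrow> 'g::ab_group_add \<Rightarrow> 'g"
    and scS :: "'k \<Rightarrow> 's::comm_ring_1 \<Rightarrow> 's"
    and j :: "'g \<Rightarrow> 's" +
  fixes m :: "'g \<Rightarrow> 'g \<Rightarrow> 'g"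
  assumes bilinear_m: "is_bilinear scG m"
begin

abbreviation B :: "'s \<Rightarrow> 's \<Rightarrow> 's" where
  "B \<equiv> btl scS j m"

lemma btl_word: "B (word j xs) (word j ys) = btl_words j m xs ys"
  and linear_btl_left: "linS (\<lambda>s. B s t)"
  and linear_btl_right: "linS (B s)"
  using induced_induced[OF presS vsS, of "btl_words j m"] btl_words_vanish[OF bilinear_m]
  unfolding btl_def[abs_def] by blast+

definition M :: "'g \<Rightarrow> 's \<Rightarrow> 's" where
  "M v X = B X (j v) - X * j v"

lemma linear_M: "linS (M v)"
  unfolding M_def by (intro linear_diff_fun linear_btl_left lin_mult)

text \<open>A one-letter right word admits the empty matching, whose term is the commutative product
  that \<open>M\<close> subtracts, and the matchings with one edge.\<close>

lemma M_word: "M v (word j xs) =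
    (\<Sum>p<length xs. j (m (xs ! p) v) * (\<Prod>i\<in>{..<length xs} - {p}. j (xs ! i)))"
proof -
  have "matchings {..<length xs} {..<length [v]} = insert {} ((\<lambda>p. {(p, 0)}) ` {..<length xs})"
  proof (intro set_eqI iffI)
    fix N
    assume "N \<in> matchings {..<length xs} {..<length [v]}"
    then have N: "N \<subseteq> {..<length xs} \<times> {0}" "inj_on snd N" by (auto simp: matchings_def)
    show "N \<in> insert {} ((\<lambda>p. {(p, 0)}) ` {..<length xs})"
    proof (cases "N = {}")
      case False
      then obtain p where p: "(p, 0) \<in> N" using N(1) by auto
      have "e = (p, 0)" if "e \<in> N" for e
        using inj_onD[OF N(2) _ that p] N(1) that by auto
      then have "N = {(p, 0)}" using p by blast
      then show ?thesis using p N(1) by auto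
    qed simp
  qed (auto simp: matchings_def)
  then have "btl_words j m xs [v] = matching_term j m xs [v] {} +
      (\<Sum>N\<in>(\<lambda>p. {(p, 0)}) ` {..<length xs}. matching_term j m xs [v] N)"
    unfolding btl_words_matchings by (simp only:) (rule sum.insert, auto)
  also have "(\<Sum>N\<in>(\<lambda>p. {(p, 0)}) ` {..<length xs}. matching_term j m xs [v] N) =
    (\<Sum>p<length xs. j (m (xs ! p) v) * (\<Prod>i\<in>{..<length xs} - {p}. j (xs ! i)))"
    by (subst sum.reindex) (auto simp: inj_on_def matching_term_def mult.commute intro!: sum.cong)
  also have "matching_term j m xs [v] {} = word j xs * j v"
    by (simp add: matching_term_def prod_word)
  finally show ?thesis
    using btl_word[of xs "[v]"] by (simp add: M_def)
qed

lemma M_1: "M v 1 = 0"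
  using M_word[of v "[]"] by simp

lemma M_j: "M v (j u) = j (m u v)"
  using M_word[of v "[u]"] by simp

lemma M_j_mult: "M v (j x * X) = M v (j x) * X + j x * M v X"
proof (rule lin_eqI[of scS "\<lambda>X. M v (j x * X)"])
  show "linS (\<lambda>X. M v (j x * X))"
    by (rule linear_comp_fun[OF linear_M lin_mult(1)])
  show "linS (\<lambda>X. M v (j x) * X + j x * M v X)"
    by (intro linear_add_fun lin_mult linear_comp_fun[OF lin_mult(1) linear_M])
  fix xs :: "'g list"
  \<comment> \<open>Position 0 holds the new letter \<open>x\<close>; the other summands are those
    of \<open>xs\<close>, shifted by one.\<close>
  have 0: "{..<Suc (length xs)} - {0} = Suc ` {..<length xs}"
    by (auto simp: image_iff less_Suc_eq_0_disj)
  have Suc: "{..<Suc (length xs)} - {Suc p} = insert 0 (Suc ` ({..<length xs} - {p}))" for p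
    by (auto simp: image_iff less_Suc_eq_0_disj)
  show "M v (j x * word j xs) = M v (j x) * word j xs + j x * M v (word j xs)"
    using M_word[of v "x # xs"] unfolding M_word[of v xs] M_j
    by (simp add: sum.lessThan_Suc_shift 0 Suc prod.reindex sum_distrib_left
        mult.left_commute prod_word[symmetric] del: sum.lessThan_Suc)
qed

definition derivation :: "('s \<Rightarrow> 's) \<Rightarrow> bool" where
  "derivation \<delta> \<longleftrightarrow> linS \<delta> \<and> (\<forall>X Y. \<delta> (X * Y) = \<delta> X * Y + X * \<delta> Y)"

lemma derivation_M: "derivation (M v)"
proof -
  have "M v (word j xs * Y) = M v (word j xs) * Y + word j xs * M v Y" for xs Y
  proof (induction xs)
    case (Cons x xs)
    then show ?case
      using M_j_mult[of v x "word j xs * Y"] M_j_mult[of v x "word j xs"]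
      by (simp add: mult.assoc distrib_right distrib_left)
  qed (simp add: M_1)
  then have "M v (X * Y) = M v X * Y + X * M v Y" for X Y
    by (rule lin_eqI[OF linear_comp_fun[OF linear_M lin_mult(2)]
          linear_add_fun[OF linear_comp_fun[OF lin_mult(2) linear_M] lin_mult(2)]])
  then show ?thesis by (simp add: derivation_def linear_M)
qed

lemma derivation_1:
  assumes "derivation \<delta>"
  shows "\<delta> 1 = 0"
proof -
  have "\<delta> (1 * 1) = \<delta> 1 * 1 + 1 * \<delta> 1" using assms unfolding derivation_def by blast
  then show ?thesis by simp
qed

lemma derivation_eqI:
  assumes "derivation \<delta>" "derivation \<delta>'" "\<And>u. \<delta> (j u) = \<delta>' (j u)"
  shows "\<delta> X = \<delta>' X"
proof (rule lin_eqI[of scS \<delta> \<delta>'])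
  show "linS \<delta>" "linS \<delta>'" using assms by (simp_all add: derivation_def)
  show "\<delta> (word j xs) = \<delta>' (word j xs)" for xs
    using assms by (induction xs) (simp_all add: derivation_1 derivation_def)
qed

lemma derivation_diff:
  assumes "derivation \<delta>" "derivation \<delta>'"
  shows "derivation (\<lambda>X. \<delta> X - \<delta>' X)"
  using assms by (auto simp: derivation_def linear_diff_fun algebra_simps)

lemma derivation_commutator:
  assumes "derivation \<delta>" "derivation \<delta>'"
  shows "derivation (\<lambda>X. \<delta> (\<delta>' X) - \<delta>' (\<delta> X))"
proof -
  have "linS \<delta>" "linS \<delta>'" using assms by (auto simp: derivation_def)
  then have "linS (\<lambda>X. \<delta> (\<delta>' X) - \<delta>' (\<delta> X))"
    using linear_diff_fun[OF linear_comp_fun linear_comp_fun] by blast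
  moreover note linearD(1)[OF \<open>linS \<delta>\<close>] linearD(1)[OF \<open>linS \<delta>'\<close>]
  ultimately show ?thesis using assms by (auto simp: derivation_def algebra_simps)
qed

text \<open>Updated families \<open>g(p := _)\<close> keep every summand a product over the same
  \<open>A\<close>, so inductions on \<open>A\<close> with \<open>g\<close> arbitrary can apply
  their hypothesis to it.\<close>

lemma derivation_prod:
  assumes "derivation \<delta>" "\<And>u. \<delta> (j u) = j (d u)" "finite A"
  shows "\<delta> (\<Prod>p\<in>A. j (g p)) = (\<Sum>p\<in>A. \<Prod>r\<in>A. j ((g(p := d (g p))) r))"
  using assms(3)
proof induction
  case empty
  then show ?case by (simp add: derivation_1[OF assms(1)])
next
  case (insert q A)
  have "(\<Prod>r\<in>A. j ((g(q := d (g q))) r)) = (\<Prod>r\<in>A. j (g r))"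
    using insert(2) by (intro prod.cong) auto
  moreover have "(\<Prod>r\<in>insert q A. j ((g(p := d (g p))) r)) = j (g q) * (\<Prod>r\<in>A. j ((g(p := d (g p))) r))"
    if "p \<in> A" for p
    using insert that by auto
  moreover have "\<delta> (\<Prod>p\<in>insert q A. j (g p)) =
     j (d (g q)) * (\<Prod>p\<in>A. j (g p)) + j (g q) * \<delta> (\<Prod>p\<in>A. j (g p))"
    using assms(1,2) insert by (simp add: derivation_def)
  ultimately show ?case
    using insert by (simp add: sum_distrib_left)
qed

end

section \<open>Extensions of two related products\<close>

lemma is_extensionD:
  assumes "is_extension scS j P b E"
  shows "is_bilinear scS E" "E (j u) (j v) = j (b u v)" "E X 1 = X"
    "E 1 X = scS (counit scS j X) 1" "E X (P Y (j y)) = E (E X Y) (j y) - E X (E Y (j y))"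
    "E (P X Y) Z = sweedler scS (\<lambda>Z1 Z2. P (E X Z1) (E Y Z2)) (coproduct scS j Z)"
  using assms unfolding is_extension_def by blast+

locale two_extensions = symmetric_algebra_product scG scS j m
  for scG :: "'k::field \<Rightarrow> 'g::ab_group_add \<Rightarrow> 'g"
    and scS :: "'k \<Rightarrow> 's::comm_ring_1 \<Rightarrow> 's"
    and j :: "'g \<Rightarrow> 's"
    and m :: "'g \<Rightarrow> 'g \<Rightarrow> 'g" +
  fixes b :: "'g \<Rightarrow> 'g \<Rightarrow> 'g" and st bu :: "'s \<Rightarrow> 's \<Rightarrow> 's"
  assumes m_assoc: "m (m u v) w = m u (m v w)"
    and b_m: "b (m u v) w = m (b u w) v + m u (b v w)"
    and st: "is_extension scS j B b st"
    and bu: "is_extension scS j (*) (\<lambda>u v. b u v + m u v) bu"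
begin

lemmas stD = is_extensionD[OF st] and buD = is_extensionD[OF bu]

lemma linear_ext:
  "linS (\<lambda>X. st X Y)" "linS (st X)" "linS (\<lambda>X. bu X Y)" "linS (bu X)"
  using stD(1) buD(1) by (auto simp: is_bilinear_def)

lemma is_bilinear_comp:
  assumes "is_bilinear scS P" "linS h" "linS h'"
  shows "is_bilinear scS (\<lambda>x y. P (h x) (h' y))"
proof -
  have "linS (P x)" "linS (\<lambda>x. P x y)" for x y
    using assms(1) by (auto simp: is_bilinear_def)
  then show ?thesis
    unfolding is_bilinear_def using assms(2,3)
    by (auto intro: linear_comp_fun[of scS scS _ scS h'] linear_comp_fun[of scS scS _ scS h])
qed

text \<open>\<open>j y\<close> is primitive and \<open>bu X 1 = X\<close>, so the coproduct rule
  collapses to the Leibniz rule.\<close>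

lemma derivation_bu: "derivation (\<lambda>X. bu X (j y))"
proof -
  have "is_bilinear scS (*)" using lin_mult by (simp add: is_bilinear_def)
  then have "is_bilinear scS (\<lambda>Z1 Z2. bu X Z1 * bu Y Z2)" for X Y
    by (rule is_bilinear_comp) (rule linear_ext)+
  then have "bu (X * Y) (j y) = bu X (j y) * Y + X * bu Y (j y)" for X Y
    unfolding buD(6) by (simp add: sweedler_coproduct_primitive buD(3))
  then show ?thesis by (simp add: derivation_def linear_ext)
qed

text \<open>A stand-in for right multiplication \<open>st _ (j y)\<close> that is visibly a
  derivation of the commutative product; \<open>st_j\<close> identifies the two.\<close>

definition D :: "'g \<Rightarrow> 's \<Rightarrow> 's" where
  "D y X = bu X (j y) - M y X"

lemma derivation_D: "derivation (D y)"
  unfolding D_def by (intro derivation_diff derivation_bu derivation_M)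

lemma linear_D: "linS (D y)"
  using derivation_D by (simp add: derivation_def)

lemma D_j: "D y (j u) = j (b u y)"
  by (simp add: D_def buD(2) M_j linearD[OF linear_j])

lemma bu_j: "bu X (j y) = D y X + M y X"
  by (simp add: D_def)

lemma M_add: "M (u + v) X = M u X + M v X"
  by (simp add: M_def linearD[OF linear_j] linearD[OF linear_btl_right] algebra_simps)

text \<open>The commutator of two derivations is a derivation, so generators suffice, and there the
  identity is \<open>b_m\<close>.\<close>

lemma D_M: "D y (M v X) = M v (D y X) + M (b v y) X"
proof -
  have "D y (M v X) - M v (D y X) = M (b v y) X"
    by (rule derivation_eqI[OF derivation_commutator[OF derivation_D derivation_M] derivation_M])
      (simp add: D_j M_j b_m linearD[OF linear_j])
  then show ?thesis by (simp add: algebra_simps)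
qed

lemma btl_j: "B X (j v) = X * j v + M v X"
  by (simp add: M_def)

lemma st_btl_j: "st (B X (j v)) (j y) = B (st X (j y)) (j v) + B X (j (b v y))"
proof -
  have "is_bilinear scS B" using linear_btl_left linear_btl_right by (simp add: is_bilinear_def)
  then have "is_bilinear scS (\<lambda>Z1 Z2. B (st X Z1) (st (j v) Z2))"
    by (rule is_bilinear_comp) (rule linear_ext)+
  then show ?thesis
    unfolding stD(6) by (simp add: sweedler_coproduct_primitive stD(2,3))
qed

text \<open>For a new factor v, X v = X \<triangleleft> v - M v X. The first term obeys the Leibniz
  rule for \<triangleleft>; the second is a sum of products over \<open>A\<close> with one factor
  changed, which is why \<open>g\<close> must vary in the induction. \<open>D_M\<close> then
  restores the Leibniz rule of \<open>D y\<close>.\<close>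

lemma st_prod:
  assumes "finite A"
  shows "st (\<Prod>p\<in>A. j (g p)) (j y) = D y (\<Prod>p\<in>A. j (g p))"
  using assms
proof (induction A arbitrary: g)
  case empty
  interpret vector_space scS by (rule vsS)
  show ?case by (simp add: stD(4) counit_primitive derivation_1[OF derivation_D])
next
  case (insert q A)
  define X where "X = (\<Prod>p\<in>A. j (g p))"
  define v where "v = g q"
  have "st (M v X) (j y) = D y (M v X)"
    unfolding X_def derivation_prod[OF derivation_M M_j insert(1)]
    by (simp add: linearD[OF linear_ext(1)] linearD[OF linear_D] insert.IH)
  moreover have "X * j v = B X (j v) - M v X" by (simp add: btl_j)
  ultimately have "st (X * j v) (j y) = B (st X (j y)) (j v) + B X (j (b v y)) - D y (M v X)"
    by (simp add: linearD[OF linear_ext(1)] st_btl_j)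
  also have "\<dots> = D y X * j v + X * j (b v y)"
    using insert.IH[of g] by (simp add: btl_j D_M X_def)
  also have "\<dots> = D y (X * j v)"
    using derivation_D[of y] by (simp add: derivation_def D_j)
  finally show ?case
    using insert(1,2) by (simp add: X_def v_def mult.commute)
qed

lemma st_j: "st X (j y) = D y X"
  by (rule lin_eqI[OF linear_ext(1) linear_D]) (simp add: prod_word st_prod)

text \<open>The recursion for \<triangleleft> subtracts \<open>st X (D y Y)\<close>, and passing to
  the commutative product subtracts \<open>st X (M y Y)\<close>; together they form
  \<open>st X (bu Y (j y))\<close>.\<close>

lemma st_mult: "st X (Y * j y) = D y (st X Y) - st X (bu Y (j y))"
proof -
  have "Y * j y = B Y (j y) - M y Y" by (simp add: btl_j)
  then show ?thesis
    by (simp add: linearD[OF linear_ext(2)] stD(5) st_j bu_j)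
qed

lemma bu_j_prod:
  assumes "finite A"
  shows "bu (\<Prod>p\<in>A. j (g p)) (j y) =
    (\<Sum>p\<in>A. \<Prod>r\<in>A. j ((g(p := b (g p) y + m (g p) y)) r))"
  by (rule derivation_prod[OF derivation_bu _ assms]) (simp add: buD(2))

text \<open>Needed twice: \<open>bu_M\<close> asks for degree one, and the theorem reads f * G back
  into T(V)^N through \<open>the_inv j\<close>.\<close>

lemma st_range:
  assumes "finite A"
  shows "st (j f) (\<Prod>p\<in>A. j (g p)) \<in> range j"
  using assms
proof (induction A arbitrary: g)
  case empty
  show ?case by (simp add: stD(3))
next
  case (insert q A)
  \<comment> \<open>A preimage for every family at once, since \<open>bu_j_prod\<close> produces the
    families \<open>g(p := _)\<close>.\<close>
  define t where "t g = the_inv j (st (j f) (\<Prod>p\<in>A. j (g p)))" for g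
  have t: "st (j f) (\<Prod>p\<in>A. j (g p)) = j (t g)" for g
    unfolding t_def by (rule f_the_inv_into_f[OF inj_j insert.IH, symmetric])
  let ?X = "\<Prod>p\<in>A. j (g p)"
  have "st (j f) (?X * j (g q)) = j (b (t g) (g q) - (\<Sum>p\<in>A. t (g(p := b (g p) (g q) + m (g p) (g q)))))"
    unfolding st_mult t bu_j_prod[OF insert(1)]
    by (simp only: linearD[OF linear_ext(2)] t D_j linearD[OF linear_j])
  then show ?case using insert(1,2) by (simp add: mult.commute)
qed

text \<open>The hypothesis on \<open>X\<close> is needed for associativity: \<open>M w (M v X) = M (m v w) X\<close> only in degree one.\<close>

lemma bu_M:
  assumes "X \<in> range j"
  shows "bu (M v X) (j y) = M v (D y X) + M (b v y + m v y) X"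
  using assms by (auto simp: bu_j D_M M_add M_j m_assoc)

text \<open>For a new factor y, both (f \<bullet> X) \<bullet> y and f \<bullet> (X \<bullet> y) are
  expanded by the induction hypothesis. Each contains the terms in which y acts on the factor g_p
  set apart from the product, and these cancel. The rest is collected by \<open>st_mult\<close>, and
  the leftover \<open>M y (T X)\<close> is the summand of the new factor.\<close>

lemma bu_prod:
  assumes "finite A"
  shows "bu (j f) (\<Prod>p\<in>A. j (g p)) =
    st (j f) (\<Prod>p\<in>A. j (g p)) + (\<Sum>p\<in>A. M (g p) (st (j f) (\<Prod>q\<in>A - {p}. j (g q))))"
  using assms
proof (induction A arbitrary: g)
  case empty
  show ?case by (simp add: stD(3) buD(3))
next
  case (insert q A)
  define y where "y = g q"
  define d where "d u = b u y + m u y" for u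
  define T where "T = st (j f)"
  define X where "X = (\<Prod>p\<in>A. j (g p))"
  define Xp where "Xp p = (\<Prod>r\<in>A - {p}. j (g r))" for p
  have T: "linS T" unfolding T_def by (rule linear_ext)
  have IH: "bu (j f) (\<Prod>p\<in>A. j (g p)) =
    T (\<Prod>p\<in>A. j (g p)) + (\<Sum>p\<in>A. M (g p) (T (\<Prod>q\<in>A - {p}. j (g q))))" for g
    using insert.IH[of g] by (simp only: T_def)
  have bu_X: "bu X (j y) = (\<Sum>p\<in>A. \<Prod>r\<in>A. j ((g(p := d (g p))) r))"
    unfolding X_def d_def by (rule bu_j_prod[OF insert(1)])
  \<comment> \<open>Here \<open>p\<close> is the factor set apart and \<open>r\<close> the one hit
    by \<open>y\<close>: \<open>r = p\<close> changes the operator \<open>M\<close>, every other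
    \<open>r\<close> changes a factor of \<open>Xp p\<close>.\<close>
  have inner: "(\<Sum>r\<in>A. M ((g(r := d (g r))) p) (T (\<Prod>q\<in>A - {p}. j ((g(r := d (g r))) q)))) =
      M (d (g p)) (T (Xp p)) + M (g p) (T (bu (Xp p) (j y)))" if "p \<in> A" for p
  proof -
    have "bu (Xp p) (j y) = (\<Sum>r\<in>A - {p}. \<Prod>q\<in>A - {p}. j ((g(r := d (g r))) q))"
      unfolding Xp_def d_def using insert(1) by (intro bu_j_prod) simp
    then have "M (g p) (T (bu (Xp p) (j y))) =
        (\<Sum>r\<in>A - {p}. M (g p) (T (\<Prod>q\<in>A - {p}. j ((g(r := d (g r))) q))))"
      by (simp only: linearD[OF T] linearD[OF linear_M])
    moreover have "Xp p = (\<Prod>q\<in>A - {p}. j ((g(p := d (g p))) q))"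
      unfolding Xp_def by (intro prod.cong) auto
    moreover have "(\<Sum>r\<in>A - {p}. M ((g(r := d (g r))) p) (T (\<Prod>q\<in>A - {p}. j ((g(r := d (g r))) q)))) =
        (\<Sum>r\<in>A - {p}. M (g p) (T (\<Prod>q\<in>A - {p}. j ((g(r := d (g r))) q))))"
      by (intro sum.cong) auto
    ultimately show ?thesis
      unfolding sum.remove[OF insert(1) that] by (simp only: fun_upd_same)
  qed
  have bu_bu: "bu (j f) (bu X (j y)) = T (bu X (j y)) +
    (\<Sum>p\<in>A. M (d (g p)) (T (Xp p)) + M (g p) (T (bu (Xp p) (j y))))"
  proof -
    have "bu (j f) (bu X (j y)) = (\<Sum>r\<in>A. T (\<Prod>p\<in>A. j ((g(r := d (g r))) p))) +
      (\<Sum>r\<in>A. \<Sum>p\<in>A. M ((g(r := d (g r))) p) (T (\<Prod>q\<in>A - {p}. j ((g(r := d (g r))) q))))"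
      unfolding bu_X by (simp only: linearD[OF linear_ext(4)] IH sum.distrib)
    also have "(\<Sum>r\<in>A. T (\<Prod>p\<in>A. j ((g(r := d (g r))) p))) = T (bu X (j y))"
      unfolding bu_X by (simp only: linearD[OF T])
    \<comment> \<open>The sum over the factor hit by \<open>y\<close> has to become the inner one
      before \<open>inner\<close> applies.\<close>
    finally show ?thesis
      by (subst (asm) sum.swap) (simp only: inner cong: sum.cong)
  qed
  have "T (Xp p) \<in> range j" for p
    unfolding T_def Xp_def using insert(1) by (intro st_range) simp
  then have "bu (bu (j f) X) (j y) = D y (T X) + M y (T X) +
    (\<Sum>p\<in>A. M (g p) (D y (T (Xp p))) + M (d (g p)) (T (Xp p)))"
    using IH[of g] unfolding X_def[symmetric] Xp_def[symmetric]
    by (simp add: linearD[OF linear_ext(3)] bu_M d_def) (simp add: bu_j)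
  \<comment> \<open>Subtracting \<open>bu_bu\<close> removes the terms
    \<open>M (d (g p)) (T (Xp p))\<close>.\<close>
  with bu_bu have "bu (j f) (X * j y) = D y (T X) - T (bu X (j y)) + M y (T X) +
    (\<Sum>p\<in>A. M (g p) (D y (T (Xp p)) - T (bu (Xp p) (j y))))"
    unfolding buD(5) by (simp add: linearD[OF linear_M] sum.distrib sum_subtractf)
  also have "\<dots> = T (X * j y) + M y (T X) + (\<Sum>p\<in>A. M (g p) (T (Xp p * j y)))"
    unfolding T_def st_mult ..
  also have "(\<Sum>p\<in>A. M (g p) (T (Xp p * j y))) =
      (\<Sum>p\<in>A. M (g p) (T (\<Prod>r\<in>insert q A - {p}. j (g r))))"
  proof (rule sum.cong[OF refl])
    fix p assume "p \<in> A"
    then have "insert q A - {p} = insert q (A - {p})" using insert(2) by auto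
    then show "M (g p) (T (Xp p * j y)) = M (g p) (T (\<Prod>r\<in>insert q A - {p}. j (g r)))"
      using insert(1,2) by (simp add: Xp_def y_def mult.commute)
  qed
  finally show ?case
    using insert(1,2) by (simp add: X_def T_def y_def mult.commute add.assoc)
qed

end

section \<open>The formula for T(V)^N\<close>

theorem proposition16:
  fixes scV :: "'k::field \<Rightarrow> 'v::ab_group_add \<Rightarrow> 'v"
    and scT :: "'k \<Rightarrow> 't::ring_1 \<Rightarrow> 't"
    and \<iota> :: "'v \<Rightarrow> 't"
    and a :: "'k ^ 'n::finite"
    and F :: "'n \<Rightarrow> 'v \<Rightarrow> 'v"
    and scS :: "'k \<Rightarrow> 's::comm_ring_1 \<Rightarrow> 's"
    and j :: "'t ^ 'n \<Rightarrow> 's"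
    and st bu :: "'s \<Rightarrow> 's \<Rightarrow> 's"
    and f :: "'t ^ 'n"
    and g :: "nat \<Rightarrow> 't ^ 'n"
    and k :: nat
  assumes "vector_space scV"
    and "is_tensor_algebra scV scT \<iota>"
    and "is_lie_module scV a F"
    and "is_symmetric_algebra (vscale scT) scS j"
    and "is_extension scS j (btl scS j (ash scT \<iota> a)) (star scT \<iota> F) st"
    and "is_extension scS j (*) (bullet scT \<iota> a F) bu"
    and "k \<ge> 1"
  shows "bu (j f) (\<Prod>p=1..k. j (g p)) =
           st (j f) (\<Prod>p=1..k. j (g p)) +
           (\<Sum>p=1..k. j (ash scT \<iota> a (the_inv j (st (j f) (\<Prod>q\<in>{1..k} - {p}. j (g q)))) (g p)))"
proof -
  interpret star_product scV scT \<iota> F a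
    using assms(1-3)
    by (simp add: star_product_def shuffle_algebra_def star_product_axioms_def is_lie_module_def)
  interpret ext: two_extensions "vscale scT" scS j "ash scT \<iota> a" "star scT \<iota> F" st bu
  proof (intro two_extensions.intro symmetric_algebra_product.intro symmetric_algebra.intro
      two_extensions_axioms.intro symmetric_algebra_product_axioms.intro)
    show "is_extension scS j (*) (\<lambda>u v. star scT \<iota> F u v + ash scT \<iota> a u v) bu"
      using assms(6) by (simp add: bullet_def[abs_def])
  qed (fact assms vector_space_vscale is_bilinear_ash ash_assoc star_ash)+
  \<comment> \<open>The argument lies in the image of the injective \<open>j\<close>, so each
    \<open>ash\<close> term is a value of \<open>M\<close> by \<open>M_j\<close> and
    \<open>bu_prod\<close> applies.\<close>
  have "j (the_inv j (st (j f) (\<Prod>q\<in>{1..k} - {p}. j (g q)))) = st (j f) (\<Prod>q\<in>{1..k} - {p}. j (g q))" for p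
    using ext.inj_j ext.st_range[of "{1..k} - {p}"] by (intro f_the_inv_into_f) auto
  then show ?thesis
    unfolding ext.M_j[symmetric] using ext.bu_prod[of "{1..k}" f g] by simp
qed

end
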